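(* Let $m>2$. If $\rho_s$ is a stationary state of $\partial_t\rho=\varepsilon\Delta\rho^m+\nabla\cdot(\rho\nabla(W*\rho))$ with $W$ satisfying assumptions (W1), (W2) and (W4) listed in the context, then $$\rho_s(x)\le\rho_s^*:=\left(\frac{m-1}{m\varepsilon}\|W\|_{L^1(\mathbb{R}^d)}\right)^{1/(m-2)}\quad\text{for all }x\in\mathbb{R}^d.$$
   Context: Here $d\ge 1$, $\varepsilon>0$ is a constant, $\|\cdot\|$ is the Euclidean norm, and $L^1_+(\mathbb{R}^d)$ is the set of non-negative functions in $L^1(\mathbb{R}^d)$, functions equal almost everywhere being identified as usual. Convolution: $(W*\rho)(x)=\int_{\mathbb{R}^d}W(x-y)\rho(y)\,dy$. Assumptions on $W:\mathbb{R}^d\to\mathbb{R}$: (W1) $W\in C^1(\mathbb{R}^d\setminus\{0\})$ and $W$ is radially symmetric: there is $\omega:(0,\infty)\to\mathbb{R}$ with $W(x)=\omega(\|x\|)$. (W2) There is $C_\omega>0$ such that $\omega'(r)\le C_\omega r^{1-d}$ for $0<r\le 1$. (W4) $\omega'(r)>0$ for all $0<r<1$, and $\omega'(r)=\omega(r)=0$ for all $r\ge 1$. Stationary state: $\rho_s\in L^1_+(\mathbb{R}^d)$ such that $\rho_s^m\in H^1_{loc}(\mathbb{R}^d)$, $\nabla W*\rho_s\in L^1_{loc}(\mathbb{R}^d)$, and $\varepsilon\nabla\rho_s^m=-\rho_s(\nabla W*\rho_s)$ in $\operatorname{supp}\rho_s$ in the sense of distributions in $\mathbb{R}^d$. *)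

theory Defs
  imports "HOL-Analysis.Analysis"
begin

definition grad :: "('a::euclidean_space \<Rightarrow> real) \<Rightarrow> 'a \<Rightarrow> 'a" where
  "grad f x = (THE D. GDERIV f x :> D)"

definition C1_on :: "'a::euclidean_space set \<Rightarrow> ('a \<Rightarrow> real) \<Rightarrow> bool" where
  "C1_on S f \<longleftrightarrow> (\<forall>x\<in>S. f differentiable (at x)) \<and> continuous_on S (grad f)"

primrec Ck :: "nat \<Rightarrow> ('a::euclidean_space \<Rightarrow> real) \<Rightarrow> bool" where
  "Ck 0 f \<longleftrightarrow> continuous_on UNIV f"
| "Ck (Suc k) f \<longleftrightarrow> (\<forall>x. f differentiable (at x)) \<and> (\<forall>b\<in>Basis. Ck k (\<lambda>x. grad f x \<bullet> b))"

definition test_function :: "('a::euclidean_space \<Rightarrow> real) \<Rightarrow> bool" where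
  "test_function \<phi> \<longleftrightarrow> (\<forall>k. Ck k \<phi>) \<and> compact (closure {x. \<phi> x \<noteq> 0})"

definition Lp_loc :: "real \<Rightarrow> ('a::euclidean_space \<Rightarrow> 'b::euclidean_space) \<Rightarrow> bool" where
  "Lp_loc p f \<longleftrightarrow> f \<in> borel_measurable lebesgue \<and>
     (\<forall>K. compact K \<longrightarrow> set_integrable lebesgue K (\<lambda>x. norm (f x) powr p))"

text \<open>For locally integrable \<^term>\<open>u\<close> and \<^term>\<open>g\<close>: the partial derivative of \<^term>\<open>u\<close> in the
  coordinate direction \<^term>\<open>b\<close> is \<^term>\<open>g\<close>, in the sense of distributions on the whole space.\<close>

definition distr_deriv :: "'a::euclidean_space \<Rightarrow> ('a \<Rightarrow> real) \<Rightarrow> ('a \<Rightarrow> real) \<Rightarrow> bool" where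
  "distr_deriv b u g \<longleftrightarrow> (\<forall>\<phi>. test_function \<phi> \<longrightarrow>
     - (LINT x|lebesgue. u x * (grad \<phi> x \<bullet> b)) = (LINT x|lebesgue. g x * \<phi> x))"

definition H1_loc :: "('a::euclidean_space \<Rightarrow> real) \<Rightarrow> bool" where
  "H1_loc u \<longleftrightarrow> Lp_loc 2 u \<and> (\<forall>b\<in>Basis. \<exists>g. Lp_loc 2 g \<and> distr_deriv b u g)"

definition conv :: "('a::euclidean_space \<Rightarrow> 'b::euclidean_space) \<Rightarrow> ('a \<Rightarrow> real) \<Rightarrow> 'a \<Rightarrow> 'b" where
  "conv f \<rho> x = (LINT y|lebesgue. \<rho> y *\<^sub>R f (x - y))"

text \<open>The support of an almost-everywhere class: the complement of the largest open set on which
  the function vanishes almost everywhere.\<close>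

definition ess_supp :: "('a::euclidean_space \<Rightarrow> real) \<Rightarrow> 'a set" where
  "ess_supp f = - \<Union>{U. open U \<and> (AE x in lebesgue. x \<in> U \<longrightarrow> f x = 0)}"

text \<open>Elements of \<open>L\<^sup>1\<close> are represented by functions, and every clause below is invariant under
  changes on null sets. The fourth clause says that the integral defining \<open>\<nabla>W * \<rho>\<close> converges for
  almost every \<open>x\<close> (the Bochner integral is \<open>0\<close> otherwise), and the sixth that \<open>\<rho> (\<nabla>W * \<rho>)\<close>
  defines a distribution. The value of \<^term>\<open>grad W\<close> at \<open>0\<close>, where \<^term>\<open>W\<close> need not be
  differentiable, does not matter. In the last clause both sides vanish off the support; the test
  functions range over the whole space and need not be supported in the support of \<open>\<rho>\<close>.\<close>

definition stationary_state ::
    "real \<Rightarrow> real \<Rightarrow> ('a::euclidean_space \<Rightarrow> real) \<Rightarrow> ('a \<Rightarrow> real) \<Rightarrow> bool" where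
  "stationary_state \<epsilon> m W \<rho> \<longleftrightarrow>
     integrable lebesgue \<rho> \<and>
     (AE x in lebesgue. 0 \<le> \<rho> x) \<and>
     H1_loc (\<lambda>x. \<rho> x powr m) \<and>
     (AE x in lebesgue. integrable lebesgue (\<lambda>y. \<rho> y *\<^sub>R grad W (x - y))) \<and>
     Lp_loc 1 (conv (grad W) \<rho>) \<and>
     Lp_loc 1 (\<lambda>x. \<rho> x *\<^sub>R conv (grad W) \<rho> x) \<and>
     (\<forall>b\<in>Basis. distr_deriv b (\<lambda>x. \<epsilon> * \<rho> x powr m)
        (\<lambda>x. - (indicator (ess_supp \<rho>) x * \<rho> x * (conv (grad W) \<rho> x \<bullet> b))))"

end

theory Submission
  imports Defs
begin

text \<open>
  Put \<open>f = \<epsilon> m / (m - 1) \<rho>\<^bsup>m - 1\<^esup>\<close> and \<open>\<Phi> = (- W) * \<rho>\<close>; since \<open>\<omega>\<close> increases to \<open>0\<close>, \<open>\<Phi> \<ge> 0\<close>.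
  Where \<open>\<rho> > 0\<close> the equation says \<open>\<nabla>f = \<nabla>\<Phi>\<close>. Restricted to almost every line in a fixed coordinate
  direction, \<open>\<rho>\<^sup>m\<close> and \<open>\<Phi>\<close> are indefinite integrals of their derivatives, so \<open>f - \<Phi>\<close> is locally
  constant where it is positive. If it were positive at one point, it would be constant on a
  whole half-line, \<open>\<rho>\<close> would be bounded below there, and this contradicts the integrability of \<open>\<rho>\<close>
  along almost every line. Hence \<open>f \<le> \<Phi>\<close> almost everywhere, without any regularity of \<open>\<rho>\<close> and without
  symmetry.

  With \<open>M\<close> the claimed bound and \<open>u = \<rho> / M\<close>, this reads \<open>u\<^bsup>m - 1\<^esup> \<le> k * u\<close> for a probability density
  \<open>k\<close>. Jensen's inequality gives that the moments \<open>\<integral> u\<^bsup>p\<^esup>\<close> with \<open>p = (m - 1)\<^bsup>n\<^esup>\<close> do not exceed \<open>\<integral> u\<close>, and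
  letting \<open>n\<close> tend to infinity yields \<open>u \<le> 1\<close>; in particular no a priori bound on \<open>\<rho>\<close> is needed.
\<close>

section \<open>Test functions\<close>

text \<open>The obstacle is the power that turns \<open>\<rho>^m\<close> into
  \<open>\<rho>^(m - 1)\<close>: its exponent \<open>(m - 1) / m\<close> is below 1, so its
  derivative blows up at 0, while \<open>\<rho>\<close> may vanish, be unbounded and is given only
  almost everywhere. The equation is therefore divided by \<open>\<rho>\<close> only on intervals
  where the continuous version of \<open>\<rho>^m\<close> on a line is positive. Such an interval
  cannot end while \<open>f - \<Phi>\<close> is a positive constant: since
  \<open>\<Phi> \<ge> 0\<close>, \<open>f\<close> stays at or above that constant, hence
  \<open>\<rho>^m\<close> cannot come down to 0. This is what extends constancy to a whole
  half-line. For \<open>\<Phi>\<close> only first derivatives of \<open>W\<close> enter. They are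
  bounded by a multiple of \<open>|x|^(1 - d)\<close>, which is integrable near the origin, so the
  increments of \<open>\<Phi>\<close> along a line can be computed under the convolution integral.
  The constant \<open>M\<close> comes from scaling. With \<open>c = \<epsilon> m / (m - 1)\<close>
  the inequality reads \<open>c \<rho>^(m - 1) \<le> (- W) * \<rho>\<close>, and a constant
  \<open>M > 0\<close> balances the two sides when \<open>c M^(m - 1) = |W|_1 M\<close>. Since
  \<open>m > 2\<close>, the exponent \<open>m - 1\<close> exceeds 1 and its powers tend to
  infinity.\<close>

lemma grad_eqI: "GDERIV f x :> D \<Longrightarrow> grad f x = D"
  unfolding grad_def
proof (rule the_equality)
  fix E assume "GDERIV f x :> D" "GDERIV f x :> E"
  then have "(\<lambda>h. h \<bullet> D) = (\<lambda>h. h \<bullet> E)"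
    unfolding gderiv_def by (rule has_derivative_unique)
  then show "E = D" by (metis inner_commute vector_eq_rdot)
qed

lemma GDERIV_grad:
  fixes f :: "'a::euclidean_space \<Rightarrow> real"
  assumes "f differentiable (at x)"
  shows "GDERIV f x :> grad f x"
proof -
  obtain f' where f': "(f has_derivative f') (at x)"
    using assms by (auto simp: differentiable_def)
  have lin: "linear f'" using f' by (rule has_derivative_linear)
  have "f' = (\<lambda>h. h \<bullet> (\<Sum>b\<in>Basis. f' b *\<^sub>R b))"
  proof
    fix h
    have "f' h = f' (\<Sum>b\<in>Basis. (h \<bullet> b) *\<^sub>R b)" by (simp add: euclidean_representation)
    also have "\<dots> = (\<Sum>b\<in>Basis. (h \<bullet> b) * f' b)"
      by (simp add: linear_sum[OF lin] linear_cmul[OF lin])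
    also have "\<dots> = h \<bullet> (\<Sum>b\<in>Basis. f' b *\<^sub>R b)"
      by (simp add: inner_sum_right mult.commute)
    finally show "f' h = h \<bullet> (\<Sum>b\<in>Basis. f' b *\<^sub>R b)" .
  qed
  with f' have "GDERIV f x :> (\<Sum>b\<in>Basis. f' b *\<^sub>R b)"
    unfolding gderiv_def by simp
  then show ?thesis using grad_eqI by force
qed

lemma GDERIV_differentiable: "GDERIV f x :> D \<Longrightarrow> f differentiable (at x)"
  unfolding gderiv_def differentiable_def by blast

text \<open>Replaces \<open>grad\<close>, a definite description, by any explicitly computed
  gradient; the inductive closure proofs for \<open>Ck\<close> go through this rule.\<close>

lemma Ck_SucI:
  assumes "\<And>x. GDERIV f x :> G x" "\<And>b. b \<in> Basis \<Longrightarrow> Ck k (\<lambda>x. G x \<bullet> b)"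
  shows "Ck (Suc k) f"
  using assms(2) GDERIV_differentiable[OF assms(1)] grad_eqI[OF assms(1)] by simp

lemma Ck_Suc_GDERIV: "Ck (Suc k) f \<Longrightarrow> GDERIV f x :> grad f x"
  by (simp add: GDERIV_grad)

lemma Ck_SucD: "Ck (Suc k) f \<Longrightarrow> Ck k f"
proof (induction k arbitrary: f)
  case 0
  then show ?case
    by (auto simp: continuous_on_eq_continuous_within intro!: differentiable_imp_continuous_within)
next
  case (Suc k)
  have "\<forall>x. f differentiable (at x)" "\<forall>b\<in>Basis. Ck k (\<lambda>x. grad f x \<bullet> b)"
    using Suc.prems Suc.IH unfolding Ck.simps(2)[of "Suc k"] by blast+
  then show ?case by simp
qed

lemma Ck_const: "Ck k (\<lambda>x. c)"
proof (induction k arbitrary: c)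
  case 0
  show ?case by simp
next
  case (Suc k)
  show ?case by (rule Ck_SucI[OF GDERIV_const]) (use Suc in simp)
qed

lemma Ck_inner: "Ck k (\<lambda>x. x \<bullet> a)"
proof (cases k)
  case (Suc l)
  have "GDERIV (\<lambda>x. x \<bullet> a) x :> a" for x
    unfolding gderiv_def by (auto intro!: derivative_eq_intros)
  then show ?thesis
    unfolding Suc by (rule Ck_SucI) (rule Ck_const)
qed (auto intro: continuous_intros)

lemma Ck_add: "Ck k f \<Longrightarrow> Ck k g \<Longrightarrow> Ck k (\<lambda>x. f x + g x)"
proof (induction k arbitrary: f g)
  case (Suc k)
  show ?case
    by (rule Ck_SucI[OF GDERIV_add[OF Ck_Suc_GDERIV[OF Suc.prems(1)] Ck_Suc_GDERIV[OF Suc.prems(2)]]])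
      (use Suc in \<open>auto simp: inner_add_left\<close>)
qed (auto intro: continuous_intros)

lemma Ck_mult: "Ck k f \<Longrightarrow> Ck k g \<Longrightarrow> Ck k (\<lambda>x. f x * g x)"
proof (induction k arbitrary: f g)
  case (Suc k)
  have "Ck k (\<lambda>x. f x * (grad g x \<bullet> b) + g x * (grad f x \<bullet> b))" if "b \<in> Basis" for b
    using Suc.prems that
    by (intro Ck_add Suc.IH Ck_SucD[OF Suc.prems(1)] Ck_SucD[OF Suc.prems(2)])
      (simp_all only: Ck.simps)
  then show ?case
    by (intro Ck_SucI[OF GDERIV_mult[OF Ck_Suc_GDERIV[OF Suc.prems(1)] Ck_Suc_GDERIV[OF Suc.prems(2)]]])
      (auto simp: inner_add_left)
qed (auto intro: continuous_intros)

lemma Ck_diff: "Ck k f \<Longrightarrow> Ck k g \<Longrightarrow> Ck k (\<lambda>x. f x - g x)"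
  using Ck_add[of k f "\<lambda>x. (- 1) * g x"] Ck_mult[OF Ck_const, of k g "- 1"] by simp

lemma Ck_power: "Ck k f \<Longrightarrow> Ck k (\<lambda>x. f x ^ n)"
  by (induction n) (auto intro: Ck_const Ck_mult)

lemma Ck_prod: "(\<And>i. i \<in> I \<Longrightarrow> Ck k (f i)) \<Longrightarrow> Ck k (\<lambda>x. \<Prod>i\<in>I. f i x)"
  by (induction I rule: infinite_finite_induct) (auto intro: Ck_const Ck_mult)

lemma GDERIV_shift: "GDERIV f (x - a) :> D \<Longrightarrow> GDERIV (\<lambda>x. f (x - a)) x :> D"
  unfolding gderiv_def
  by (rule has_derivative_compose[of "\<lambda>x. x - a" "\<lambda>h. h" x UNIV f "\<lambda>h. h \<bullet> D"])
    (auto intro!: derivative_eq_intros)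

lemma Ck_shift: "Ck k f \<Longrightarrow> Ck k (\<lambda>x. f (x - a))"
proof (induction k arbitrary: f)
  case 0
  then show ?case by (auto intro!: continuous_on_compose2[of UNIV f] continuous_intros)
next
  case (Suc k)
  show ?case
    by (rule Ck_SucI[OF GDERIV_shift[OF Ck_Suc_GDERIV[OF Suc.prems]]]) (use Suc in auto)
qed

text \<open>The classical flat function is the case \<open>j = 0\<close>. The whole family is
  carried along because derivatives of its members are again linear combinations of members.\<close>

definition flat_exp :: "nat \<Rightarrow> real \<Rightarrow> real" where
  "flat_exp j t = (if t > 0 then inverse t ^ j * exp (- inverse t) else 0)"

lemma flat_exp_nonneg: "0 \<le> flat_exp j t"
  by (simp add: flat_exp_def)

lemma power_div_fact_le_exp: "0 \<le> x \<Longrightarrow> x ^ n / fact n \<le> exp (x::real)"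
proof -
  assume x: "0 \<le> x"
  have "(\<Sum>k\<in>{n}. inverse (fact k) *\<^sub>R x ^ k) \<le> (\<Sum>k. inverse (fact k) *\<^sub>R x ^ k)"
    by (rule sum_le_suminf) (use x summable_exp[of x] in auto)
  then show ?thesis by (simp add: exp_def divide_inverse mult.commute)
qed

text \<open>Comes from the term of order \<open>j + 2\<close> in the exponential series at
  \<open>1 / t\<close>. A bound quadratic in \<open>t\<close> is what yields the derivative 0 at the
  gluing point.\<close>

lemma flat_exp_le: "flat_exp j t \<le> fact (j + 2) * t\<^sup>2"
proof (cases "t > 0")
  case True
  have "inverse t ^ (j + 2) / fact (j + 2) \<le> exp (inverse t)"
    by (rule power_div_fact_le_exp) (use True in simp)
  then have "inverse t ^ (j + 2) * exp (- inverse t) \<le> fact (j + 2)"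
    unfolding exp_minus
    by (subst (asm) pos_divide_le_eq, simp, subst divide_inverse[symmetric], subst pos_divide_le_eq)
       (simp_all add: mult.commute del: fact_Suc)
  then have "t\<^sup>2 * (inverse t ^ (j + 2) * exp (- inverse t)) \<le> t\<^sup>2 * fact (j + 2)"
    by (intro mult_left_mono) auto
  moreover have "t\<^sup>2 * (inverse t ^ (j + 2) * exp (- inverse t)) = flat_exp j t"
    using True by (simp add: flat_exp_def power_add power2_eq_square field_simps)
  ultimately show ?thesis by (simp add: mult.commute)
qed (simp add: flat_exp_def)

lemma DERIV_zero_of_quadratic_bound:
  fixes f :: "real \<Rightarrow> real"
  assumes "\<And>t. \<bar>f t\<bar> \<le> c * t\<^sup>2"
  shows "DERIV f 0 :> 0"
proof -
  have f0: "f 0 = 0" using assms[of 0] by simp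
  have "(\<lambda>h. f h / h) \<midarrow>0\<rightarrow> 0"
  proof (rule Lim_null_comparison)
    show "\<forall>\<^sub>F h in at 0. norm (f h / h) \<le> c * \<bar>h\<bar>"
    proof (rule eventuallyI)
      fix h :: real
      have "c \<ge> 0" using assms[of 1] by simp
      show "norm (f h / h) \<le> c * \<bar>h\<bar>"
      proof (cases "h = 0")
        case False
        have "\<bar>f h\<bar> \<le> c * \<bar>h\<bar> * \<bar>h\<bar>"
          using assms[of h] by (simp add: power2_eq_square mult.assoc)
        then show ?thesis
          using False by (simp add: pos_divide_le_eq)
      qed simp
    qed
    show "(\<lambda>h::real. c * \<bar>h\<bar>) \<midarrow>0\<rightarrow> 0" by (auto intro!: tendsto_eq_intros)
  qed
  then show ?thesis by (simp add: DERIV_def f0)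
qed

lemma DERIV_flat_exp:
  "DERIV (flat_exp j) t :> flat_exp (j + 2) t - real j * flat_exp (Suc j) t"
proof -
  consider "t > 0" | "t < 0" | "t = 0" by linarith
  then show ?thesis
  proof cases
    case 1
    have "DERIV (\<lambda>t. inverse t ^ j * exp (- inverse t)) t :> 
        real j * (- (inverse t ^ 2)) * inverse t ^ (j - 1) * exp (- inverse t)
        + inverse t ^ 2 * exp (- inverse t) * inverse t ^ j"
      using 1 by (auto intro!: derivative_eq_intros simp: power2_eq_square)
    also have "real j * (- (inverse t ^ 2)) * inverse t ^ (j - 1) * exp (- inverse t)
        + inverse t ^ 2 * exp (- inverse t) * inverse t ^ j
        = flat_exp (j + 2) t - real j * flat_exp (Suc j) t"
      \<comment> \<open>For \<open>j = 0\<close> the truncated exponent \<open>j - 1\<close> is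
        harmless, since the factor \<open>real j\<close> is 0.\<close>
      using 1 by (cases j) (simp_all add: flat_exp_def power2_eq_square algebra_simps)
    finally show ?thesis
      by (rule has_field_derivative_transform_within_open[of _ _ _ "{0<..}"]) 
        (use 1 in \<open>auto simp: flat_exp_def\<close>)
  next
    case 2
    have "DERIV (\<lambda>t. 0) t :> flat_exp (j + 2) t - real j * flat_exp (Suc j) t"
      using 2 by (simp add: flat_exp_def)
    then show ?thesis
      by (rule has_field_derivative_transform_within_open[of _ _ _ "{..<0}"]) 
        (use 2 in \<open>auto simp: flat_exp_def\<close>)
  next
    case 3
    have "DERIV (flat_exp j) 0 :> 0"
      by (rule DERIV_zero_of_quadratic_bound[of _ "fact (j + 2)"])
         (use flat_exp_nonneg flat_exp_le in \<open>simp add: abs_of_nonneg del: fact_Suc\<close>)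
    then show ?thesis using 3 by (simp add: flat_exp_def)
  qed
qed

text \<open>The induction on \<open>k\<close> needs \<open>j\<close> arbitrary, because each
  differentiation raises \<open>j\<close>.\<close>

lemma Ck_flat_exp_compose:
  assumes "\<And>l. Ck l q"
  shows "Ck k (\<lambda>x. flat_exp j (q x))"
proof (induction k arbitrary: j)
  case 0
  have "continuous_on UNIV (flat_exp j)"
    using DERIV_continuous_on[OF DERIV_flat_exp[of j]] .
  moreover have "continuous_on UNIV q" using assms[of 0] by simp
  ultimately show ?case by (simp add: continuous_on_compose2)
next
  case (Suc k)
  have "GDERIV (\<lambda>x. flat_exp j (q x)) x :>
      (flat_exp (j + 2) (q x) - real j * flat_exp (Suc j) (q x)) *\<^sub>R grad q x" for x
    by (rule GDERIV_DERIV_compose[OF Ck_Suc_GDERIV[OF assms] DERIV_flat_exp])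
  then show ?case
  proof (rule Ck_SucI)
    fix b :: 'a assume "b \<in> Basis"
    then have "Ck k (\<lambda>x. grad q x \<bullet> b)" using assms[of "Suc k"] by simp
    then have "Ck k (\<lambda>x. (flat_exp (j + 2) (q x) - real j * flat_exp (Suc j) (q x)) * (grad q x \<bullet> b))"
      by (intro Ck_mult Ck_diff Suc Ck_const)
    then show "Ck k (\<lambda>x. ((flat_exp (j + 2) (q x) - real j * flat_exp (Suc j) (q x)) *\<^sub>R grad q x) \<bullet> b)"
      by simp
  qed
qed

section \<open>The fundamental lemma of the calculus of variations\<close>

definition box_bump :: "'a::euclidean_space \<Rightarrow> 'a \<Rightarrow> 'a \<Rightarrow> real" where
  "box_bump a b x = (\<Prod>i\<in>Basis. flat_exp 0 ((x \<bullet> i - a \<bullet> i) * (b \<bullet> i - x \<bullet> i)))"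

lemma Ck_box_bump: "Ck k (box_bump a b)"
  unfolding box_bump_def
  by (intro Ck_prod Ck_flat_exp_compose Ck_mult Ck_diff Ck_inner Ck_const)

lemma flat_exp_0_le_1: "flat_exp 0 t \<le> 1"
  by (simp add: flat_exp_def)

lemma box_bump_range: "0 \<le> box_bump a b x \<and> box_bump a b x \<le> 1"
  unfolding box_bump_def
  by (auto intro!: prod_nonneg prod_le_1 flat_exp_nonneg flat_exp_0_le_1)

text \<open>The ordering matters: if both factors are negative, as between
  \<open>b \<bullet> i\<close> and \<open>a \<bullet> i\<close> in the reversed order, their product
  is positive although the box is empty.\<close>

lemma box_bump_pos_iff:
  assumes "\<And>i. i \<in> Basis \<Longrightarrow> a \<bullet> i \<le> b \<bullet> i"
  shows "0 < box_bump a b x \<longleftrightarrow> x \<in> box a b"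
proof -
  have *: "0 < (s - p) * (q - s) \<longleftrightarrow> p < s \<and> s < q" if "p \<le> q" for p q s :: real
    using that by (auto simp: zero_less_mult_iff)
  have "0 < box_bump a b x \<longleftrightarrow> (\<forall>i\<in>Basis. flat_exp 0 ((x \<bullet> i - a \<bullet> i) * (b \<bullet> i - x \<bullet> i)) \<noteq> 0)"
    using box_bump_range[of a b x] by (auto simp: box_bump_def less_le)
  also have "\<dots> \<longleftrightarrow> (\<forall>i\<in>Basis. 0 < (x \<bullet> i - a \<bullet> i) * (b \<bullet> i - x \<bullet> i))"
    by (auto simp: flat_exp_def)
  finally show ?thesis
    using * assms by (auto simp: mem_box)
qed

text \<open>As \<open>n\<close> grows these test functions increase to the indicator function of the box, which makes
  mollification unnecessary.\<close>

lemma test_function_box_bump_power: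
  assumes "\<And>i. i \<in> Basis \<Longrightarrow> a \<bullet> i \<le> b \<bullet> i"
  shows "test_function (\<lambda>x. 1 - (1 - box_bump a b x) ^ n)"
  unfolding test_function_def
proof (intro conjI allI)
  show "Ck k (\<lambda>x. 1 - (1 - box_bump a b x) ^ n)" for k
    by (intro Ck_diff Ck_power Ck_const Ck_box_bump)
  have "{x. 1 - (1 - box_bump a b x) ^ n \<noteq> 0} \<subseteq> box a b"
    using box_bump_range[of a b] by (force simp flip: box_bump_pos_iff[OF assms] simp: less_le)
  then show "compact (closure {x. 1 - (1 - box_bump a b x) ^ n \<noteq> 0})"
    using bounded_box bounded_subset compact_closure by blast
qed

text \<open>Borel rather than Lebesgue measurability makes composites such as
  \<open>g (x + t *\<^sub>R b)\<close> measurable on the product space, as Fubini's theorem for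
  \<open>lborel\<close> requires.\<close>

definition loc_integrable :: "('a::euclidean_space \<Rightarrow> real) \<Rightarrow> bool" where
  "loc_integrable u \<longleftrightarrow> u \<in> borel_measurable borel \<and>
     (\<forall>R. integrable lborel (\<lambda>x. indicator (ball 0 R) x * u x))"

lemma loc_integrable_mult_bounded:
  assumes "loc_integrable u" and [measurable]: "f \<in> borel_measurable borel"
    and "\<And>x. \<bar>f x\<bar> \<le> B * indicator (ball 0 R) x"
  shows "integrable lborel (\<lambda>x. u x * f x)"
proof (rule Bochner_Integration.integrable_bound)
  show "integrable lborel (\<lambda>x. B * (indicator (ball 0 R) x * u x))"
    using assms(1) by (auto simp: loc_integrable_def)
  have [measurable]: "u \<in> borel_measurable borel" using assms(1) by (simp add: loc_integrable_def)
  show "(\<lambda>x. u x * f x) \<in> borel_measurable lborel" by simp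
  show "AE x in lborel. norm (u x * f x) \<le> norm (B * (indicator (ball 0 R) x * u x))"
  proof (intro AE_I2)
    fix x
    have "norm (u x * f x) \<le> \<bar>u x\<bar> * (B * indicator (ball 0 R) x)"
      using assms(3)[of x] by (simp add: abs_mult mult_left_mono)
    also have "\<dots> \<le> \<bar>u x\<bar> * (\<bar>B\<bar> * indicator (ball 0 R) x)"
      by (intro mult_left_mono mult_right_mono) auto
    finally show "norm (u x * f x) \<le> norm (B * (indicator (ball 0 R) x * u x))"
      by (simp add: abs_mult mult_ac)
  qed
qed

lemma integral_box_eq_0:
  assumes u: "loc_integrable u"
    and 0: "\<And>\<phi>. test_function \<phi> \<Longrightarrow> (LINT x|lborel. u x * \<phi> x) = 0"
  shows "(LINT x|lborel. u x * indicator (box a b) x) = 0"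
proof (cases "\<forall>i\<in>Basis. a \<bullet> i \<le> b \<bullet> i")
  case False
  then have "box a b = {}" by (force simp: box_eq_empty)
  then show ?thesis by simp
next
  case True
  define f where "f n x = 1 - (1 - box_bump a b x) ^ n" for n x
  have [measurable]: "u \<in> borel_measurable borel" using u by (simp add: loc_integrable_def)
  have [measurable]: "box_bump a b \<in> borel_measurable borel"
    using Ck_box_bump[of 0 a b] by (simp add: borel_measurable_continuous_onI)
  have supp: "0 < box_bump a b x \<longleftrightarrow> x \<in> box a b" for x
    using box_bump_pos_iff True by blast
  have f01: "0 \<le> f n x \<and> f n x \<le> indicator (box a b) x" for n x
  proof (cases "x \<in> box a b")
    case True
    then show ?thesis using box_bump_range[of a b x] by (auto simp: f_def power_le_one)
  next
    case False
    then have "box_bump a b x = 0" using supp[of x] box_bump_range[of a b x] by linarith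
    then show ?thesis using False by (simp add: f_def)
  qed
  have "(\<lambda>n. LINT x|lborel. u x * f n x) \<longlonglongrightarrow> (LINT x|lborel. u x * indicator (box a b) x)"
  proof (rule integral_dominated_convergence)
    obtain R where R: "box a b \<subseteq> ball 0 R"
      using bounded_box bounded_subset_ballD by blast
    have int: "integrable lborel (\<lambda>x. u x * indicator (box a b) x)"
      by (rule loc_integrable_mult_bounded[OF u, of _ 1 R]) (use R in \<open>auto simp: indicator_def\<close>)
    from int show "integrable lborel (\<lambda>x. norm (u x * indicator (box a b) x))"
      by (rule integrable_norm)
    show "AE x in lborel. (\<lambda>n. u x * f n x) \<longlonglongrightarrow> u x * indicator (box a b) x"
    proof (intro AE_I2 tendsto_mult tendsto_const)
      fix x
      show "(\<lambda>n. f n x) \<longlonglongrightarrow> indicator (box a b) x"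
      proof (cases "x \<in> box a b")
        case True
        then have "(\<lambda>n. (1 - box_bump a b x) ^ n) \<longlonglongrightarrow> 0"
          using supp[of x] box_bump_range[of a b x] by (intro LIMSEQ_power_zero) auto
        from tendsto_diff[OF tendsto_const[of 1] this] True show ?thesis by (simp add: f_def)
      next
        case False
        then have "f n x = 0" for n using f01[of n x] by (simp add: indicator_def)
        then show ?thesis using False by simp
      qed
    qed
    show "AE x in lborel. norm (u x * f n x) \<le> norm (u x * indicator (box a b) x)" for n
      using f01[of n] by (auto intro!: AE_I2 mult_left_mono simp: abs_mult)
    show "(\<lambda>x. u x * f n x) \<in> borel_measurable lborel" for n
      unfolding f_def by simp
  qed simp
  moreover have "(LINT x|lborel. u x * f n x) = 0" for n
    unfolding f_def by (rule 0[OF test_function_box_bump_power]) (use True in auto)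
  ultimately show ?thesis by (simp add: LIMSEQ_const_iff)
qed

text \<open>Since \<open>ennreal\<close> truncates negative numbers to 0,
  \<open>ennreal (u x)\<close> and \<open>ennreal (- u x)\<close> are the positive and negative
  parts. The measures with these densities agree on boxes, an intersection-stable generator, hence
  everywhere; so the two parts coincide almost everywhere, which leaves only the value 0.\<close>

lemma AE_eq_0_of_box_integrals:
  assumes u: "loc_integrable u"
    and 0: "\<And>a b. (LINT x|lborel. u x * indicator (box a b) x) = 0"
  shows "AE x in lborel. u x = 0"
proof -
  have [measurable]: "u \<in> borel_measurable borel" using u by (simp add: loc_integrable_def)
  have em: "emeasure (density lborel (\<lambda>x. ennreal (v x))) (box a b)
      = ennreal (LINT x|lborel. max 0 (v x) * indicator (box a b) x)"
    if v: "loc_integrable v" for v :: "'a \<Rightarrow> real" and a b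
  proof -
    have [measurable]: "v \<in> borel_measurable borel" using v by (simp add: loc_integrable_def)
    obtain R where R: "box a b \<subseteq> ball (0::'a) R"
      using bounded_box bounded_subset_ballD by blast
    have i: "integrable lborel (\<lambda>x. v x * indicator (box a b) x)"
      by (rule loc_integrable_mult_bounded[OF v, of _ 1 R]) (use R in \<open>auto simp: indicator_def\<close>)
    have "integrable lborel (\<lambda>x. max 0 (v x) * indicator (box a b) x)"
      by (rule Bochner_Integration.integrable_bound[OF i]) (auto simp: indicator_def)
    then have "(\<integral>\<^sup>+x. ennreal (max 0 (v x) * indicator (box a b) x) \<partial>lborel)
        = ennreal (LINT x|lborel. max 0 (v x) * indicator (box a b) x)"
      by (rule nn_integral_eq_integral) auto
    moreover have "ennreal (max 0 (v x) * indicator (box a b) x) = ennreal (v x) * indicator (box a b) x" for x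
      by (auto simp: indicator_def max_def ennreal_neg)
    ultimately show ?thesis by (simp add: emeasure_density)
  qed
  have um: "loc_integrable (\<lambda>x. - u x)" using u by (auto simp: loc_integrable_def)
  have eq: "emeasure (density lborel (\<lambda>x. ennreal (u x))) (box a b) =
      emeasure (density lborel (\<lambda>x. ennreal (- u x))) (box a b)" for a b
  proof -
    obtain R where R: "box a b \<subseteq> ball (0::'a) R"
      using bounded_box bounded_subset_ballD by blast
    have i: "integrable lborel (\<lambda>x. u x * indicator (box a b) x)"
      by (rule loc_integrable_mult_bounded[OF u, of _ 1 R]) (use R in \<open>auto simp: indicator_def\<close>)
    have i1: "integrable lborel (\<lambda>x. max 0 (u x) * indicator (box a b) x)"
      by (rule Bochner_Integration.integrable_bound[OF i]) (auto simp: indicator_def)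
    have i2: "integrable lborel (\<lambda>x. max 0 (- u x) * indicator (box a b) x)"
      by (rule Bochner_Integration.integrable_bound[OF i]) (auto simp: indicator_def)
    have "(LINT x|lborel. max 0 (u x) * indicator (box a b) x) - (LINT x|lborel. max 0 (- u x) * indicator (box a b) x)
      = (LINT x|lborel. max 0 (u x) * indicator (box a b) x - max 0 (- u x) * indicator (box a b) x)"
      using i1 i2 by simp
    also have "\<dots> = (LINT x|lborel. u x * indicator (box a b) x)"
      by (intro Bochner_Integration.integral_cong) (auto simp: indicator_def)
    finally show ?thesis using 0 em[OF u] em[OF um] by simp
  qed
  have "density lborel (\<lambda>x. ennreal (u x)) = density lborel (\<lambda>x. ennreal (- u x))"
  proof (rule measure_eqI_generator_eq[where E="range (\<lambda>(a, b). box a b)" and \<Omega>=UNIV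
        and A="\<lambda>n. box (- (real n *\<^sub>R One)) (real n *\<^sub>R One)"])
    show "Int_stable (range (\<lambda>(a, b). box a b :: 'a set))"
      by (auto simp: Int_stable_def box_Int_box)
    show "(\<Union>n. box (- (real n *\<^sub>R One)) (real n *\<^sub>R One)) = (UNIV::'a set)"
      by (simp add: UN_box_eq_UNIV)
    show "emeasure (density lborel (\<lambda>x. ennreal (u x))) (box (- (real n *\<^sub>R One)) (real n *\<^sub>R One)) \<noteq> \<infinity>" for n
      by (simp add: em[OF u])
    show "emeasure (density lborel (\<lambda>x. ennreal (u x))) X =
        emeasure (density lborel (\<lambda>x. ennreal (- u x))) X"
      if "X \<in> range (\<lambda>(a, b). box a b)" for X
      using that eq by auto
    show "range (\<lambda>n. box (- (real n *\<^sub>R One)) (real n *\<^sub>R One)) \<subseteq> range (\<lambda>(a, b). box a (b::'a))"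
      by auto
  qed (simp_all add: borel_eq_box)
  then have "AE x in lborel. ennreal (u x) = ennreal (- u x)"
    by (intro sigma_finite_measure.density_unique[OF sigma_finite_lborel]) auto
  then show ?thesis
  proof eventually_elim
    case (elim x)
    then show ?case by (cases "u x \<le> 0") (auto simp: ennreal_neg ennreal_eq_0_iff)
  qed
qed

lemma fundamental_lemma:
  assumes "loc_integrable u"
    and "\<And>\<phi>. test_function \<phi> \<Longrightarrow> (LINT x|lborel. u x * \<phi> x) = 0"
  shows "AE x in lborel. u x = 0"
  by (rule AE_eq_0_of_box_integrals[OF assms(1) integral_box_eq_0[OF assms]])

section \<open>Restriction to lines\<close>

lemma ball_in_sets_borel [measurable]: "ball c r \<in> sets (borel :: 'a::euclidean_space measure)"
  by simp

lemma integrable_abs_le: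
  fixes f g :: "'a \<Rightarrow> real"
  assumes "integrable M f" "g \<in> borel_measurable M" "\<And>x. \<bar>g x\<bar> \<le> \<bar>f x\<bar>"
  shows "integrable M g"
  using assms by (intro Bochner_Integration.integrable_bound[OF assms(1,2)]) auto

section \<open>Translations, and integrability on almost every line\<close>

lemma nn_integral_shift:
  fixes f :: "'a::euclidean_space \<Rightarrow> ennreal"
  assumes "f \<in> borel_measurable borel"
  shows "(\<integral>\<^sup>+x. f (x + c) \<partial>lborel) = (\<integral>\<^sup>+x. f x \<partial>lborel)"
  using nn_integral_distr[of "(+) c" lborel borel f] assms by (simp add: lborel_distr_plus add.commute)

lemma integral_shift:
  fixes f :: "'a::euclidean_space \<Rightarrow> real"
  assumes "f \<in> borel_measurable borel"
  shows "(LINT x|lborel. f (x + c)) = (LINT x|lborel. f x)"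
  using integral_distr[of "(+) c" lborel borel f] assms by (simp add: lborel_distr_plus add.commute)

lemma integrable_shift:
  fixes f :: "'a::euclidean_space \<Rightarrow> real"
  assumes "integrable lborel f"
  shows "integrable lborel (\<lambda>x. f (x + c))"
  using integrable_distr_eq[of "(+) c" lborel borel f] assms
  by (simp add: lborel_distr_plus add.commute)

lemma AE_shift:
  fixes P :: "'a::euclidean_space \<Rightarrow> bool"
  assumes "AE x in lborel. P x"
  shows "AE x in lborel. P (x + c)"
proof -
  obtain N where N: "{x. \<not> P x} \<subseteq> N" "emeasure lborel N = 0" "N \<in> sets borel"
    using AE_E[OF assms] by auto
  have "(\<integral>\<^sup>+x. indicator N (x + c) \<partial>lborel) = 0"
    using nn_integral_shift[of "indicator N" c] N by simp
  then have "AE x in lborel. indicator N (x + c) = (0::ennreal)"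
    using N(3) by (subst (asm) nn_integral_0_iff_AE) auto
  then show ?thesis
    by eventually_elim (use N(1) in \<open>auto simp: indicator_def split: if_splits\<close>)
qed

text \<open>Averaging the line integrals over a ball turns them into an integral over the whole space,
  since a ball meets every line in a segment of bounded length.\<close>

lemma AE_nn_integral_line_finite:
  fixes f :: "'a::euclidean_space \<Rightarrow> ennreal"
  assumes [measurable]: "f \<in> borel_measurable borel"
    and fin: "(\<integral>\<^sup>+x. f x \<partial>lborel) < \<infinity>" and b: "norm b = 1"
  shows "AE x in lborel. (\<integral>\<^sup>+t. f (x + t *\<^sub>R b) \<partial>lborel) < \<infinity>"
proof -
  have "AE x in lborel. x \<in> ball 0 (real R) \<longrightarrow> (\<integral>\<^sup>+t. f (x + t *\<^sub>R b) \<partial>lborel) < \<infinity>" for R :: nat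
  proof -
    have len: "(\<integral>\<^sup>+t. indicator (ball 0 (real R)) (y + t *\<^sub>R (- b)) \<partial>lborel) \<le> ennreal (2 * real R)" for y
    proof -
      have "indicator (ball 0 (real R)) (y + t *\<^sub>R (- b))
          \<le> (indicator {y \<bullet> b - real R .. y \<bullet> b + real R} t :: ennreal)" for t
      proof -
        have "\<bar>(y + t *\<^sub>R (- b)) \<bullet> b\<bar> \<le> norm (y + t *\<^sub>R (- b))"
          using Cauchy_Schwarz_ineq2[of "y + t *\<^sub>R (- b)" b] b by simp
        moreover have "b \<bullet> b = 1" using b by (simp add: dot_square_norm)
        ultimately show ?thesis
          by (auto simp: indicator_def inner_diff_left abs_le_iff)
      qed
      then have "(\<integral>\<^sup>+t. indicator (ball 0 (real R)) (y + t *\<^sub>R (- b)) \<partial>lborel)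
          \<le> (\<integral>\<^sup>+t. indicator {y \<bullet> b - real R .. y \<bullet> b + real R} t \<partial>lborel)"
        by (intro nn_integral_mono) 
      then show ?thesis by simp
    qed
    have "(\<integral>\<^sup>+x. indicator (ball 0 (real R)) x * (\<integral>\<^sup>+t. f (x + t *\<^sub>R b) \<partial>lborel) \<partial>lborel)
        = (\<integral>\<^sup>+x. \<integral>\<^sup>+t. indicator (ball 0 (real R)) x * f (x + t *\<^sub>R b) \<partial>lborel \<partial>lborel)"
      by (intro nn_integral_cong nn_integral_cmult[symmetric]) simp
    also have "\<dots> = (\<integral>\<^sup>+t. \<integral>\<^sup>+x. indicator (ball 0 (real R)) x * f (x + t *\<^sub>R b) \<partial>lborel \<partial>lborel)"
      by (rule lborel_pair.Fubini'[symmetric]) simp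
    also have "\<dots> = (\<integral>\<^sup>+t. \<integral>\<^sup>+x. indicator (ball 0 (real R)) (x + t *\<^sub>R (- b)) * f x \<partial>lborel \<partial>lborel)"
    proof (rule nn_integral_cong)
      fix t :: real
      show "(\<integral>\<^sup>+x. indicator (ball 0 (real R)) x * f (x + t *\<^sub>R b) \<partial>lborel)
          = (\<integral>\<^sup>+x. indicator (ball 0 (real R)) (x + t *\<^sub>R (- b)) * f x \<partial>lborel)"
        using nn_integral_shift[of "\<lambda>x. indicator (ball 0 (real R)) (x + t *\<^sub>R (- b)) * f x" "t *\<^sub>R b"]
        by simp
    qed
    also have "\<dots> = (\<integral>\<^sup>+x. \<integral>\<^sup>+t. indicator (ball 0 (real R)) (x + t *\<^sub>R (- b)) * f x \<partial>lborel \<partial>lborel)"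
      by (rule lborel_pair.Fubini') simp
    also have "\<dots> = (\<integral>\<^sup>+x. (\<integral>\<^sup>+t. indicator (ball 0 (real R)) (x + t *\<^sub>R (- b)) \<partial>lborel) * f x \<partial>lborel)"
      by (intro nn_integral_cong nn_integral_multc) simp
    also have "\<dots> \<le> (\<integral>\<^sup>+x. ennreal (2 * real R) * f x \<partial>lborel)"
      by (intro nn_integral_mono mult_right_mono len) simp
    also have "\<dots> = ennreal (2 * real R) * (\<integral>\<^sup>+x. f x \<partial>lborel)"
      by (rule nn_integral_cmult) simp
    also have "\<dots> < \<infinity>" using fin by (simp add: ennreal_mult_less_top)
    finally have "AE x in lborel. indicator (ball 0 (real R)) x * (\<integral>\<^sup>+t. f (x + t *\<^sub>R b) \<partial>lborel) \<noteq> \<infinity>"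
      by (intro nn_integral_PInf_AE) auto
    then show ?thesis by eventually_elim (auto simp: less_top)
  qed
  then have "AE x in lborel. \<forall>R::nat. x \<in> ball 0 (real R) \<longrightarrow> (\<integral>\<^sup>+t. f (x + t *\<^sub>R b) \<partial>lborel) < \<infinity>"
    by (intro AE_all_countable[THEN iffD2] allI)
  then show ?thesis
  proof eventually_elim
    case (elim x)
    obtain R :: nat where "norm x < real R" using reals_Archimedean2 by blast
    then show ?case using elim by auto
  qed
qed

text \<open>Cutting \<open>g\<close> off outside balls of integer radius needs only countably many
  null sets, and these serve all \<open>s\<close> at once: a segment of length \<open>s\<close> from
  \<open>x\<close> lies in every ball of radius exceeding
  \<open>norm x + \<bar>s\<bar>\<close>.\<close>

lemma AE_integrable_segment:
  assumes g: "loc_integrable g" and b: "norm b = 1"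
  shows "AE x in lborel. \<forall>s. integrable lborel (\<lambda>t. indicator {0..s} t * g (x + t *\<^sub>R b))"
proof -
  have [measurable]: "g \<in> borel_measurable borel" using g by (simp add: loc_integrable_def)
  have "AE x in lborel. (\<integral>\<^sup>+t. ennreal (norm (indicator (ball 0 (real R)) (x + t *\<^sub>R b) * g (x + t *\<^sub>R b))) \<partial>lborel) < \<infinity>"
    for R :: nat
  proof (rule AE_nn_integral_line_finite[OF _ _ b, of "\<lambda>x. ennreal (norm (indicator (ball 0 (real R)) x * g x))"])
    have "integrable lborel (\<lambda>x. indicator (ball 0 (real R)) x * g x)"
      using g by (simp add: loc_integrable_def)
    then show "(\<integral>\<^sup>+x. ennreal (norm (indicator (ball 0 (real R)) x * g x)) \<partial>lborel) < \<infinity>"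
      unfolding integrable_iff_bounded by blast
  qed measurable
  then have "AE x in lborel. \<forall>R::nat. (\<integral>\<^sup>+t. ennreal (norm (indicator (ball 0 (real R)) (x + t *\<^sub>R b) * g (x + t *\<^sub>R b))) \<partial>lborel) < \<infinity>"
    by (intro AE_all_countable[THEN iffD2] allI)
  then show ?thesis
  proof (eventually_elim, intro allI)
    case (elim x)
    fix s
    obtain R :: nat where R: "norm x + \<bar>s\<bar> < real R" using reals_Archimedean2 by blast
    have le: "\<bar>indicator {0..s} t * g (x + t *\<^sub>R b)\<bar> \<le> \<bar>indicator (ball 0 (real R)) (x + t *\<^sub>R b) * g (x + t *\<^sub>R b)\<bar>" for t
    proof (cases "t \<in> {0..s}")
      case True
      have "norm (x + t *\<^sub>R b) \<le> norm x + \<bar>t\<bar>" using norm_triangle_ineq[of x "t *\<^sub>R b"] b by simp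
      then show ?thesis using R True by auto
    qed simp
    have int: "integrable lborel (\<lambda>t. indicator (ball 0 (real R)) (x + t *\<^sub>R b) * g (x + t *\<^sub>R b))"
      unfolding integrable_iff_bounded
    proof
      show "(\<lambda>t. indicator (ball 0 (real R)) (x + t *\<^sub>R b) * g (x + t *\<^sub>R b)) \<in> borel_measurable lborel"
        by measurable
    qed (use elim in blast)
    show "integrable lborel (\<lambda>t. indicator {0..s} t * g (x + t *\<^sub>R b))"
      by (rule integrable_abs_le[OF int _ le]) measurable
  qed
qed

text \<open>Integrating in \<open>x\<close> first removes the shift by \<open>t *\<^sub>R v\<close>,
  so the double integral is at most \<open>s\<close> times the integral of
  \<open>\<bar>G\<bar>\<close>. The case \<open>v = 0\<close> is used as well.\<close>

lemma integrable_shear: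
  fixes h :: "'a::euclidean_space \<times> real \<Rightarrow> real"
  assumes G: "integrable lborel G" and [measurable]: "h \<in> borel_measurable (lborel \<Otimes>\<^sub>M lborel)"
    and le: "\<And>x t. \<bar>h (x, t)\<bar> \<le> indicator {0..s} t * \<bar>G (x + t *\<^sub>R v)\<bar>"
  shows "integrable (lborel \<Otimes>\<^sub>M lborel) h"
proof (rule integrableI_bounded)
  have [measurable]: "G \<in> borel_measurable borel" using G by auto
  have "(\<integral>\<^sup>+z. ennreal (norm (h z)) \<partial>(lborel \<Otimes>\<^sub>M lborel)) = (\<integral>\<^sup>+t. \<integral>\<^sup>+x. ennreal (norm (h (x, t))) \<partial>lborel \<partial>lborel)"
    by (rule lborel_pair.nn_integral_snd[symmetric]) simp
  also have "\<dots> \<le> (\<integral>\<^sup>+t. \<integral>\<^sup>+x. indicator {0..s} t * ennreal \<bar>G (x + t *\<^sub>R v)\<bar> \<partial>lborel \<partial>lborel)"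
  proof (intro nn_integral_mono)
    fix x :: 'a and t :: real
    have "ennreal (norm (h (x, t))) \<le> ennreal (indicator {0..s} t * \<bar>G (x + t *\<^sub>R v)\<bar>)"
      using le[of x t] by (intro ennreal_leI) simp
    also have "\<dots> = indicator {0..s} t * ennreal \<bar>G (x + t *\<^sub>R v)\<bar>"
      by (simp add: indicator_def)
    finally show "ennreal (norm (h (x, t))) \<le> indicator {0..s} t * ennreal \<bar>G (x + t *\<^sub>R v)\<bar>" .
  qed
  also have "\<dots> = (\<integral>\<^sup>+t. indicator {0..s} t * (\<integral>\<^sup>+x. ennreal \<bar>G x\<bar> \<partial>lborel) \<partial>lborel)"
    by (intro nn_integral_cong, subst nn_integral_cmult)
      (auto simp: nn_integral_shift[of "\<lambda>x. ennreal \<bar>G x\<bar>"])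
  also have "\<dots> = ennreal (if 0 \<le> s then s else 0) * (\<integral>\<^sup>+x. ennreal \<bar>G x\<bar> \<partial>lborel)"
    by (subst nn_integral_multc) auto
  also have "\<dots> < \<infinity>"
    using G by (simp add: ennreal_mult_less_top integrable_iff_bounded)
  finally show "(\<integral>\<^sup>+z. ennreal (norm (h z)) \<partial>(lborel \<Otimes>\<^sub>M lborel)) < \<infinity>" .
qed simp

section \<open>Increments along a segment as line integrals\<close>

definition segint :: "'a::euclidean_space \<Rightarrow> ('a \<Rightarrow> real) \<Rightarrow> real \<Rightarrow> 'a \<Rightarrow> real" where
  "segint b g s x = (LINT t|lborel. indicator {0..s} t * g (x + t *\<^sub>R b))"

lemma measurable_segint_pair [measurable]:
  assumes [measurable]: "g \<in> borel_measurable borel"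
  shows "(\<lambda>z. segint b g (snd z) (fst z)) \<in> borel_measurable (borel \<Otimes>\<^sub>M borel)"
  unfolding segint_def indicator_def atLeastAtMost_iff by measurable

lemma measurable_segint [measurable]:
  assumes [measurable]: "g \<in> borel_measurable borel"
  shows "segint b g s \<in> borel_measurable borel"
  unfolding segint_def by measurable

lemma test_function_bounds:
  assumes "test_function \<phi>"
  obtains R B where "R > 0" "\<And>x. \<bar>\<phi> x\<bar> \<le> B * indicator (ball 0 R) x"
    "\<And>x. \<bar>grad \<phi> x \<bullet> b\<bar> \<le> B * indicator (ball 0 R) x"
proof -
  define K where "K = closure {x. \<phi> x \<noteq> 0}"
  have Ck: "Ck k \<phi>" for k using assms by (simp add: test_function_def)
  have K: "compact K" using assms by (simp add: test_function_def K_def)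
  obtain R where R: "K \<subseteq> ball 0 R" "R > 0"
    using bounded_subset_ballD[OF compact_imp_bounded[OF K]] by blast
  have "continuous_on UNIV (grad \<phi>)"
    unfolding continuous_on_componentwise[of UNIV "grad \<phi>"] using Ck[of "Suc 0"] by simp
  then have "continuous_on K (\<lambda>x. grad \<phi> x \<bullet> b)" 
    by (intro continuous_on_inner continuous_on_const) (rule continuous_on_subset, auto)
  then have "bounded ((\<lambda>x. grad \<phi> x \<bullet> b) ` K)"
    using K compact_continuous_image compact_imp_bounded by blast
  then obtain B1 where B1: "\<And>x. x \<in> K \<Longrightarrow> \<bar>grad \<phi> x \<bullet> b\<bar> \<le> B1"
    by (auto simp: bounded_iff)
  have "continuous_on K \<phi>" using Ck[of 0] by (simp add: continuous_on_subset[of UNIV])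
  then have "bounded (\<phi> ` K)"
    using K compact_continuous_image compact_imp_bounded by blast
  then obtain B2 where B2: "\<And>x. x \<in> K \<Longrightarrow> \<bar>\<phi> x\<bar> \<le> B2"
    by (auto simp: bounded_iff)
  have out: "\<phi> x = 0 \<and> grad \<phi> x = 0" if "x \<notin> K" for x
  proof
    have z: "\<phi> y = 0" if "y \<in> - K" for y
      using that closure_subset[of "{x. \<phi> x \<noteq> 0}"] unfolding K_def by blast
    show "\<phi> x = 0" using that z[of x] by blast
    have "((\<lambda>x. 0) has_derivative (\<lambda>h. 0)) (at x)" by simp
    then have "(\<phi> has_derivative (\<lambda>h. 0)) (at x)"
      by (rule has_derivative_transform_within_open[of _ _ _ _ "- K"])
        (use that z K in \<open>simp_all add: open_Compl compact_imp_closed\<close>)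
    then have "GDERIV \<phi> x :> 0" by (simp add: gderiv_def)
    then show "grad \<phi> x = 0" by (rule grad_eqI)
  qed
  let ?B = "max 0 (max B1 B2)"
  show ?thesis
  proof (rule that[of R ?B])
    show "R > 0" by fact
    show "\<bar>\<phi> x\<bar> \<le> ?B * indicator (ball 0 R) x" for x
      using R B2[of x] out[of x] by (cases "x \<in> K") (auto simp: indicator_def)
    show "\<bar>grad \<phi> x \<bullet> b\<bar> \<le> ?B * indicator (ball 0 R) x" for x
      using R B1[of x] out[of x] by (cases "x \<in> K") (auto simp: indicator_def)
  qed
qed

lemma loc_integrable_measurable: "loc_integrable u \<Longrightarrow> u \<in> borel_measurable borel"
  by (simp add: loc_integrable_def)

lemma integrable_imp_loc_integrable:
  fixes f :: "'a::euclidean_space \<Rightarrow> real"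
  assumes "integrable lborel f" 
  shows "loc_integrable f"
  unfolding loc_integrable_def
proof (intro conjI allI)
  show [measurable]: "f \<in> borel_measurable borel" using assms by auto
  show "integrable lborel (\<lambda>x. indicator (ball 0 R) x * f x)" for R
    by (rule integrable_abs_le[OF assms]) (measurable, simp add: indicator_def)
qed

lemma loc_integrable_diff: 
  assumes "loc_integrable u" "loc_integrable v" 
  shows "loc_integrable (\<lambda>x. u x - v x)"
  using assms by (auto simp: loc_integrable_def right_diff_distrib)

lemma loc_integrable_shift:
  assumes u: "loc_integrable u"
  shows "loc_integrable (\<lambda>x. u (x + c))"
  unfolding loc_integrable_def
proof (intro conjI allI)
  have [measurable]: "u \<in> borel_measurable borel" using u by (rule loc_integrable_measurable)
  show "(\<lambda>x. u (x + c)) \<in> borel_measurable borel" by measurable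
  fix R
  have int: "integrable lborel (\<lambda>x. indicator (ball 0 (R + norm c)) (x + c) * u (x + c))"
    by (rule integrable_shift) (use u in \<open>simp add: loc_integrable_def\<close>)
  have "\<bar>indicator (ball 0 R) x * u (x + c)\<bar> \<le> \<bar>indicator (ball 0 (R + norm c)) (x + c) * u (x + c)\<bar>" for x
    using norm_triangle_ineq[of x c] by (auto simp: indicator_def)
  then show "integrable lborel (\<lambda>x. indicator (ball 0 R) x * u (x + c))"
    by (rule integrable_abs_le[OF int, rotated]) measurable
qed

lemma integrable_segment_pair:
  assumes g: "loc_integrable g" and [measurable]: "f \<in> borel_measurable borel"
    and f: "\<And>x. \<bar>f x\<bar> \<le> B * indicator (ball 0 R) x" and b: "norm b = 1"
  shows "integrable (lborel \<Otimes>\<^sub>M lborel) (\<lambda>(x, t). f x * (indicator {0..s} t * g (x + t *\<^sub>R b)))"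
proof (rule integrable_shear[of "\<lambda>x. B * (indicator (ball 0 (R + \<bar>s\<bar>)) x * g x)" _ s b])
  have [measurable]: "g \<in> borel_measurable borel" using g by (rule loc_integrable_measurable)
  show "(\<lambda>(x, t). f x * (indicator {0..s} t * g (x + t *\<^sub>R b))) \<in> borel_measurable (lborel \<Otimes>\<^sub>M lborel)"
    by measurable
  show "integrable lborel (\<lambda>x. B * (indicator (ball 0 (R + \<bar>s\<bar>)) x * g x))"
    using g by (auto simp: loc_integrable_def)
  fix x :: 'a and t :: real
  show "\<bar>case (x, t) of (x, t) \<Rightarrow> f x * (indicator {0..s} t * g (x + t *\<^sub>R b))\<bar>
    \<le> indicator {0..s} t * \<bar>B * (indicator (ball 0 (R + \<bar>s\<bar>)) (x + t *\<^sub>R b) * g (x + t *\<^sub>R b))\<bar>"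
  proof (cases "t \<in> {0..s} \<and> x \<in> ball 0 R")
    case True
    then have "x + t *\<^sub>R b \<in> ball 0 (R + \<bar>s\<bar>)"
      using norm_triangle_ineq[of x "t *\<^sub>R b"] b by auto
    moreover have "\<bar>f x\<bar> \<le> \<bar>B\<bar>" using True f[of x] by simp
    ultimately show ?thesis using True by (simp add: abs_mult mult_right_mono)
  next
    case False
    then have "f x = 0 \<or> t \<notin> {0..s}" using f[of x] by auto
    then show ?thesis by auto
  qed
qed

lemma loc_integrable_segint:
  assumes g: "loc_integrable g" and b: "norm b = 1"
  shows "loc_integrable (segint b g s)"
  unfolding loc_integrable_def
proof (intro conjI allI)
  have [measurable]: "g \<in> borel_measurable borel" using g by (rule loc_integrable_measurable)
  show "segint b g s \<in> borel_measurable borel" by measurable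
  fix R
  show "integrable lborel (\<lambda>x. indicator (ball 0 R) x * segint b g s x)"
    using lborel_pair.integrable_fst[OF integrable_segment_pair[OF g _ _ b, of "indicator (ball 0 R)" 1 R s]]
    by (simp add: segint_def)
qed

lemma test_function_shift: 
  assumes "test_function \<phi>" shows "test_function (\<lambda>x. \<phi> (x - a))"
  unfolding test_function_def
proof (intro conjI allI)
  show "Ck k (\<lambda>x. \<phi> (x - a))" for k using assms by (simp add: Ck_shift test_function_def)
  have "{x. \<phi> (x - a) \<noteq> 0} = (+) a ` {x. \<phi> x \<noteq> 0}"
    by (auto simp: image_iff) (metis add.commute diff_add_cancel)
  then have "closure {x. \<phi> (x - a) \<noteq> 0} = (+) a ` closure {x. \<phi> x \<noteq> 0}"
    by (simp add: closure_translation)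
  then show "compact (closure {x. \<phi> (x - a) \<noteq> 0})"
    using assms by (simp add: compact_translation test_function_def)
qed

text \<open>By Fubini, testing \<open>segint b g s\<close> against \<open>\<phi>\<close> amounts to testing \<open>g\<close> against the translates of \<open>\<phi>\<close>
  along \<open>b\<close>, where the distributional equation applies.\<close>

lemma distr_deriv_segment:
  fixes u g :: "'a::euclidean_space \<Rightarrow> real"
  assumes u: "loc_integrable u" and g: "loc_integrable g" and b: "norm b = 1" and s: "0 \<le> s"
    and distr: "\<And>\<phi>. test_function \<phi> \<Longrightarrow>
      - (LINT x|lborel. u x * (grad \<phi> x \<bullet> b)) = (LINT x|lborel. g x * \<phi> x)"
  shows "AE x in lborel. u (x + s *\<^sub>R b) - u x = segint b g s x"
proof -
  have [measurable]: "u \<in> borel_measurable borel" "g \<in> borel_measurable borel"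
    using u g by (auto intro: loc_integrable_measurable)
  have "AE x in lborel. u (x + s *\<^sub>R b) - u x - segint b g s x = 0"
  proof (rule fundamental_lemma)
    show "loc_integrable (\<lambda>x. u (x + s *\<^sub>R b) - u x - segint b g s x)"
      by (intro loc_integrable_diff loc_integrable_shift loc_integrable_segint u g b)
    fix \<phi> :: "'a \<Rightarrow> real" assume \<phi>: "test_function \<phi>"
    have Ck: "Ck k \<phi>" for k using \<phi> by (simp add: test_function_def)
    obtain R B where R: "R > 0" and B: "\<And>x. \<bar>\<phi> x\<bar> \<le> B * indicator (ball 0 R) x"
      "\<And>x. \<bar>grad \<phi> x \<bullet> b\<bar> \<le> B * indicator (ball 0 R) x"
      using test_function_bounds[OF \<phi>] by metis
    define \<psi> where "\<psi> x = grad \<phi> x \<bullet> b" for x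
    have "continuous_on UNIV \<phi>" using Ck[of 0] by simp
    then have [measurable]: "\<phi> \<in> borel_measurable borel" by (rule borel_measurable_continuous_onI)
    have "continuous_on UNIV (grad \<phi>)"
      unfolding continuous_on_componentwise[of UNIV "grad \<phi>"] using Ck[of "Suc 0"] by simp
    then have cont: "continuous_on UNIV \<psi>"
      unfolding \<psi>_def by (intro continuous_on_inner continuous_on_const)
    then have [measurable]: "\<psi> \<in> borel_measurable borel" by (rule borel_measurable_continuous_onI)

    have "(LINT x|lborel. \<phi> x * segint b g s x)
        = (LINT x|lborel. LINT t|lborel. \<phi> x * (indicator {0..s} t * g (x + t *\<^sub>R b)))"
      by (simp add: segint_def)
    also have "\<dots> = (LINT t|lborel. LINT x|lborel. \<phi> x * (indicator {0..s} t * g (x + t *\<^sub>R b)))"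
      by (rule lborel_pair.Fubini_integral[symmetric])
        (rule integrable_segment_pair[OF g _ B(1) b], measurable)
    also have "\<dots> = (LINT t|lborel. - (LINT x|lborel. u x * (indicator {0..s} t * \<psi> (x - t *\<^sub>R b))))"
    proof (rule Bochner_Integration.integral_cong[OF refl])
      fix t :: real
      have "(LINT x|lborel. \<phi> x * (indicator {0..s} t * g (x + t *\<^sub>R b)))
          = indicator {0..s} t * (LINT x|lborel. \<phi> x * g (x + t *\<^sub>R b))"
        by (cases "t \<in> {0..s}") simp_all
      also have "(LINT x|lborel. \<phi> x * g (x + t *\<^sub>R b)) = (LINT x|lborel. g x * \<phi> (x - t *\<^sub>R b))"
        using integral_shift[of "\<lambda>x. g x * \<phi> (x - t *\<^sub>R b)" "t *\<^sub>R b"] by (simp add: mult.commute)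
      also have "\<dots> = - (LINT x|lborel. u x * (grad (\<lambda>x. \<phi> (x - t *\<^sub>R b)) x \<bullet> b))"
        by (rule distr[OF test_function_shift[OF \<phi>], symmetric])
      also have "\<dots> = - (LINT x|lborel. u x * \<psi> (x - t *\<^sub>R b))"
        using grad_eqI[OF GDERIV_shift[OF Ck_Suc_GDERIV[OF Ck]]] by (simp add: \<psi>_def)
      finally show "(LINT x|lborel. \<phi> x * (indicator {0..s} t * g (x + t *\<^sub>R b)))
          = - (LINT x|lborel. u x * (indicator {0..s} t * \<psi> (x - t *\<^sub>R b)))"
        by (cases "t \<in> {0..s}") simp_all
    qed
    also have "\<dots> = - (LINT t|lborel. LINT x|lborel. u x * (indicator {0..s} t * \<psi> (x - t *\<^sub>R b)))"
      by (rule Bochner_Integration.integral_minus)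
    also have "(LINT t|lborel. LINT x|lborel. u x * (indicator {0..s} t * \<psi> (x - t *\<^sub>R b)))
       = (LINT x|lborel. LINT t|lborel. u x * (indicator {0..s} t * \<psi> (x - t *\<^sub>R b)))"
    \<comment> \<open>The shift now sits on the bounded factor \<open>\<psi>\<close> and not on
      \<open>u\<close>, hence the shear direction 0; the ball is enlarged by
      \<open>\<bar>s\<bar>\<close> to contain all translates of the support.\<close>
    proof (rule lborel_pair.Fubini_integral, rule integrable_shear[of "\<lambda>x. B * (indicator (ball 0 (R + \<bar>s\<bar>)) x * u x)" _ s 0])
      show "integrable lborel (\<lambda>x. B * (indicator (ball 0 (R + \<bar>s\<bar>)) x * u x))"
        using u by (auto simp: loc_integrable_def)
      fix x :: 'a and t :: real
      show "\<bar>case (x, t) of (x, t) \<Rightarrow> u x * (indicator {0..s} t * \<psi> (x - t *\<^sub>R b))\<bar>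
        \<le> indicator {0..s} t * \<bar>B * (indicator (ball 0 (R + \<bar>s\<bar>)) (x + t *\<^sub>R 0) * u (x + t *\<^sub>R 0))\<bar>"
      proof (cases "t \<in> {0..s} \<and> x - t *\<^sub>R b \<in> ball 0 R")
        case True
        then have "x \<in> ball 0 (R + \<bar>s\<bar>)"
          using norm_triangle_ineq[of "x - t *\<^sub>R b" "t *\<^sub>R b"] b by auto
        moreover have "\<bar>\<psi> (x - t *\<^sub>R b)\<bar> \<le> \<bar>B\<bar>" using True B(2)[of "x - t *\<^sub>R b"] by (simp add: \<psi>_def)
        ultimately show ?thesis using True by (simp add: abs_mult mult_right_mono mult.commute[of "\<bar>u x\<bar>"])
      next
        case False
        then have "\<psi> (x - t *\<^sub>R b) = 0 \<or> t \<notin> {0..s}" using B(2)[of "x - t *\<^sub>R b"] by (auto simp: \<psi>_def)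
        then show ?thesis by auto
      qed
    qed measurable
    \<comment> \<open>In \<open>t\<close>, \<open>\<psi> (x - t *\<^sub>R b)\<close> is the
      derivative of \<open>- \<phi> (x - t *\<^sub>R b)\<close>, so the inner integral telescopes;
      moving the translation back onto \<open>u\<close> later produces the increment of
      \<open>u\<close>.\<close>
    also have "\<dots> = (LINT x|lborel. u x * (\<phi> x - \<phi> (x - s *\<^sub>R b)))"
    proof (rule Bochner_Integration.integral_cong[OF refl])
      fix x
      have "(LINT t|lborel. \<psi> (x - t *\<^sub>R b) * indicator {0..s} t) = - \<phi> (x - s *\<^sub>R b) - - \<phi> (x - 0 *\<^sub>R b)"
      proof (rule integral_FTC_Icc_real[OF s])
        fix t
        have 1: "((\<lambda>t. x - t *\<^sub>R b) has_derivative (\<lambda>h. - h *\<^sub>R b)) (at t)"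
          by (auto intro!: derivative_eq_intros)
        have "(\<phi> has_derivative (\<lambda>h. h \<bullet> grad \<phi> (x - t *\<^sub>R b))) (at (x - t *\<^sub>R b))"
          using Ck_Suc_GDERIV[OF Ck] by (simp add: gderiv_def)
        then have "((\<lambda>t. \<phi> (x - t *\<^sub>R b)) has_derivative (\<lambda>h. (- h *\<^sub>R b) \<bullet> grad \<phi> (x - t *\<^sub>R b))) (at t)"
          by (rule has_derivative_compose[OF 1])
        then have "((\<lambda>t. \<phi> (x - t *\<^sub>R b)) has_real_derivative - \<psi> (x - t *\<^sub>R b)) (at t)"
          unfolding has_field_derivative_def
          by (rule has_derivative_eq_rhs) (simp add: fun_eq_iff \<psi>_def inner_commute[of b])
        then show "((\<lambda>t. - \<phi> (x - t *\<^sub>R b)) has_real_derivative \<psi> (x - t *\<^sub>R b)) (at t)"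
          using DERIV_minus by fastforce
        have "continuous_on UNIV (\<lambda>t. \<psi> (x - t *\<^sub>R b))"
          by (rule continuous_on_compose2[OF cont]) (auto intro!: continuous_intros)
        then show "isCont (\<lambda>t. \<psi> (x - t *\<^sub>R b)) t"
          by (simp add: continuous_on_eq_continuous_at)
      qed
      then show "(LINT t|lborel. u x * (indicator {0..s} t * \<psi> (x - t *\<^sub>R b))) = u x * (\<phi> x - \<phi> (x - s *\<^sub>R b))"
        by (simp add: mult.commute)
    qed
    finally have seg: "(LINT x|lborel. \<phi> x * segint b g s x) = - (LINT x|lborel. u x * (\<phi> x - \<phi> (x - s *\<^sub>R b)))" .
    have i1: "integrable lborel (\<lambda>x. u x * \<phi> x)"
      by (rule loc_integrable_mult_bounded[OF u _ B(1)]) measurable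
    have i2: "integrable lborel (\<lambda>x. u (x + s *\<^sub>R b) * \<phi> x)"
      by (rule loc_integrable_mult_bounded[OF loc_integrable_shift[OF u] _ B(1)]) measurable
    have i3: "integrable lborel (\<lambda>x. segint b g s x * \<phi> x)"
      by (rule loc_integrable_mult_bounded[OF loc_integrable_segint[OF g b] _ B(1)]) measurable
    have i4: "integrable lborel (\<lambda>x. u x * \<phi> (x - s *\<^sub>R b))"
      using integrable_shift[OF i2, of "- (s *\<^sub>R b)"] by simp
    have "(LINT x|lborel. u (x + s *\<^sub>R b) * \<phi> x) = (LINT x|lborel. u x * \<phi> (x - s *\<^sub>R b))"
      using integral_shift[of "\<lambda>x. u x * \<phi> (x - s *\<^sub>R b)" "s *\<^sub>R b"] by simp
    then show "(LINT x|lborel. (u (x + s *\<^sub>R b) - u x - segint b g s x) * \<phi> x) = 0"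
      using i1 i2 i3 i4 seg by (simp add: left_diff_distrib right_diff_distrib mult.commute[of "\<phi> _"])
  qed
  then show ?thesis by eventually_elim simp
qed

section \<open>Convolutions and their increments along segments\<close>

lemma lborel_distr_reflect: "distr lborel borel (\<lambda>y. x - y) = (lborel :: 'a::euclidean_space measure)"
  by (subst lborel_affine[of "-1" x]) (auto simp: density_1)

lemma nn_integral_reflect:
  fixes f :: "'a::euclidean_space \<Rightarrow> ennreal"
  assumes "f \<in> borel_measurable borel"
  shows "(\<integral>\<^sup>+y. f (x - y) \<partial>lborel) = (\<integral>\<^sup>+y. f y \<partial>lborel)"
  using nn_integral_distr[of "(\<lambda>y. x - y)" lborel borel f] assms by (simp add: lborel_distr_reflect)

lemma AE_reflect:
  fixes P :: "'a::euclidean_space \<Rightarrow> bool"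
  assumes "AE x in lborel. P x"
  shows "AE y in lborel. P (x - y)"
proof -
  obtain N where N: "{x. \<not> P x} \<subseteq> N" "emeasure lborel N = 0" "N \<in> sets borel"
    using AE_E[OF assms] by auto
  have "(\<integral>\<^sup>+y. indicator N (x - y) \<partial>lborel) = 0"
    using nn_integral_reflect[of "indicator N" x] N by simp
  then have "AE y in lborel. indicator N (x - y) = (0::ennreal)"
    using N(3) by (subst (asm) nn_integral_0_iff_AE) auto
  then show ?thesis
    by eventually_elim (use N(1) in \<open>auto simp: indicator_def split: if_splits\<close>)
qed

lemma nn_integral_conv:
  fixes f g :: "'a::euclidean_space \<Rightarrow> ennreal"
  assumes [measurable]: "f \<in> borel_measurable borel" "g \<in> borel_measurable borel"
  shows "(\<integral>\<^sup>+x. \<integral>\<^sup>+y. f y * g (x - y) \<partial>lborel \<partial>lborel) = (\<integral>\<^sup>+x. f x \<partial>lborel) * (\<integral>\<^sup>+x. g x \<partial>lborel)"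
proof -
  have "(\<integral>\<^sup>+x. \<integral>\<^sup>+y. f y * g (x - y) \<partial>lborel \<partial>lborel) = (\<integral>\<^sup>+y. \<integral>\<^sup>+x. f y * g (x - y) \<partial>lborel \<partial>lborel)"
    by (rule lborel_pair.Fubini'[symmetric]) measurable
  also have "\<dots> = (\<integral>\<^sup>+y. f y * (\<integral>\<^sup>+x. g x \<partial>lborel) \<partial>lborel)"
  proof (rule nn_integral_cong)
    fix y
    have "(\<integral>\<^sup>+x. f y * g (x - y) \<partial>lborel) = f y * (\<integral>\<^sup>+x. g (x - y) \<partial>lborel)"
      by (rule nn_integral_cmult) measurable
    also have "(\<integral>\<^sup>+x. g (x - y) \<partial>lborel) = (\<integral>\<^sup>+x. g x \<partial>lborel)"
      using nn_integral_shift[of g "- y"] by simp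
    finally show "(\<integral>\<^sup>+x. f y * g (x - y) \<partial>lborel) = f y * (\<integral>\<^sup>+x. g x \<partial>lborel)" .
  qed
  also have "\<dots> = (\<integral>\<^sup>+x. f x \<partial>lborel) * (\<integral>\<^sup>+x. g x \<partial>lborel)"
    by (rule nn_integral_multc) measurable
  finally show ?thesis .
qed

lemma AE_nn_integral_conv_finite:
  fixes f g :: "'a::euclidean_space \<Rightarrow> ennreal"
  assumes [measurable]: "f \<in> borel_measurable borel" "g \<in> borel_measurable borel"
    and "(\<integral>\<^sup>+x. f x \<partial>lborel) < \<infinity>" "(\<integral>\<^sup>+x. g x \<partial>lborel) < \<infinity>"
  shows "AE x in lborel. (\<integral>\<^sup>+y. f y * g (x - y) \<partial>lborel) < \<infinity>"
proof -
  have "AE x in lborel. (\<integral>\<^sup>+y. f y * g (x - y) \<partial>lborel) \<noteq> \<infinity>"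
    by (rule nn_integral_PInf_AE, measurable)
      (use assms in \<open>simp add: nn_integral_conv ennreal_mult_eq_top_iff less_top\<close>)
  then show ?thesis by (simp add: less_top)
qed

lemma integrable_conv_pair:
  fixes f g :: "'a::euclidean_space \<Rightarrow> real"
  assumes f: "integrable lborel f" and g: "integrable lborel g"
  shows "integrable (lborel \<Otimes>\<^sub>M lborel) (\<lambda>(x, y). f y * g (x - y))"
proof (rule integrableI_bounded)
  have [measurable]: "f \<in> borel_measurable borel" "g \<in> borel_measurable borel" using f g by auto
  show "(\<lambda>(x, y). f y * g (x - y)) \<in> borel_measurable (lborel \<Otimes>\<^sub>M lborel)" by measurable
  have "(\<integral>\<^sup>+z. ennreal (norm (case z of (x, y) \<Rightarrow> f y * g (x - y))) \<partial>(lborel \<Otimes>\<^sub>M lborel))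
      = (\<integral>\<^sup>+x. \<integral>\<^sup>+y. ennreal (norm (f y * g (x - y))) \<partial>lborel \<partial>lborel)"
    by (subst lborel.nn_integral_fst[symmetric]) auto
  also have "\<dots> = (\<integral>\<^sup>+x. \<integral>\<^sup>+y. ennreal \<bar>f y\<bar> * ennreal \<bar>g (x - y)\<bar> \<partial>lborel \<partial>lborel)"
    by (simp add: abs_mult ennreal_mult)
  also have "\<dots> = (\<integral>\<^sup>+x. ennreal \<bar>f x\<bar> \<partial>lborel) * (\<integral>\<^sup>+x. ennreal \<bar>g x\<bar> \<partial>lborel)"
    by (rule nn_integral_conv) measurable
  also have "\<dots> < \<infinity>"
    using f g by (simp add: integrable_iff_bounded ennreal_mult_less_top)
  finally show "(\<integral>\<^sup>+z. ennreal (norm (case z of (x, y) \<Rightarrow> f y * g (x - y))) \<partial>(lborel \<Otimes>\<^sub>M lborel)) < \<infinity>" .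
qed

text \<open>The increment formula for \<open>K\<close> is convolved with \<open>\<rho>\<close>, and
  the integrals over \<open>y\<close> and \<open>t\<close> are exchanged. The exchange is made for
  each fixed \<open>x\<close> outside a null set.\<close>

lemma conv_segment:
  fixes \<rho> K L :: "'a::euclidean_space \<Rightarrow> real"
  assumes \<rho>: "integrable lborel \<rho>" and K: "integrable lborel K" and L: "integrable lborel L"
    and s: "0 \<le> s"
    and KL: "AE z in lborel. K (z + s *\<^sub>R b) - K z = segint b L s z"
  shows "AE x in lborel. (LINT y|lborel. \<rho> y * K (x + s *\<^sub>R b - y)) - (LINT y|lborel. \<rho> y * K (x - y))
    = segint b (\<lambda>x. LINT y|lborel. \<rho> y * L (x - y)) s x"
proof -
  have [measurable]: "\<rho> \<in> borel_measurable borel" "K \<in> borel_measurable borel" "L \<in> borel_measurable borel"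
    using \<rho> K L by auto
  have A: "AE x in lborel. integrable lborel (\<lambda>y. \<rho> y * K (x - y))"
    using lborel_pair.AE_integrable_fst[OF integrable_conv_pair[OF \<rho> K]] .
  note B = AE_shift[OF A, of "s *\<^sub>R b"]
  \<comment> \<open>\<open>P\<close> is the segment integral of \<open>\<bar>L\<bar>\<close>. Its
    total mass is \<open>s\<close> times that of \<open>\<bar>L\<bar>\<close>, so its convolution
    with \<open>\<bar>\<rho>\<bar>\<close> is finite almost everywhere; this is the integrability
    behind the exchange.\<close>
  define P where "P z = (\<integral>\<^sup>+t. indicator {0..s} t * ennreal \<bar>L (z + t *\<^sub>R b)\<bar> \<partial>lborel)" for z
  have [measurable]: "P \<in> borel_measurable borel" 
    unfolding P_def indicator_def atLeastAtMost_iff by measurable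
  have "(\<integral>\<^sup>+z. P z \<partial>lborel) = (\<integral>\<^sup>+t. \<integral>\<^sup>+z. indicator {0..s} t * ennreal \<bar>L (z + t *\<^sub>R b)\<bar> \<partial>lborel \<partial>lborel)"
    unfolding P_def by (rule lborel_pair.Fubini'[symmetric]) (unfold indicator_def atLeastAtMost_iff, measurable)
  also have "\<dots> = (\<integral>\<^sup>+t. indicator {0..s} t * (\<integral>\<^sup>+x. ennreal \<bar>L x\<bar> \<partial>lborel) \<partial>lborel)"
    by (intro nn_integral_cong, subst nn_integral_cmult)
      (auto simp: nn_integral_shift[of "\<lambda>x. ennreal \<bar>L x\<bar>"])
  also have "\<dots> = ennreal s * (\<integral>\<^sup>+x. ennreal \<bar>L x\<bar> \<partial>lborel)"
    using s by (subst nn_integral_multc) auto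
  also have "\<dots> < \<infinity>"
    using L by (simp add: ennreal_mult_less_top integrable_iff_bounded)
  finally have "(\<integral>\<^sup>+z. P z \<partial>lborel) < \<infinity>" .
  moreover have "(\<integral>\<^sup>+y. ennreal \<bar>\<rho> y\<bar> \<partial>lborel) < \<infinity>"
    using \<rho> by (simp add: integrable_iff_bounded)
  ultimately have C: "AE x in lborel. (\<integral>\<^sup>+y. ennreal \<bar>\<rho> y\<bar> * P (x - y) \<partial>lborel) < \<infinity>"
    by (intro AE_nn_integral_conv_finite) auto
  from A B C show ?thesis
  proof eventually_elim
    case (elim x)
    have int: "integrable (lborel \<Otimes>\<^sub>M lborel) (\<lambda>(y, t). \<rho> y * (indicator {0..s} t * L (x - y + t *\<^sub>R b)))"
    proof (rule integrableI_bounded)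
      show [measurable]: "(\<lambda>(y, t). \<rho> y * (indicator {0..s} t * L (x - y + t *\<^sub>R b))) \<in> borel_measurable (lborel \<Otimes>\<^sub>M lborel)"
        unfolding indicator_def atLeastAtMost_iff by measurable
      have "(\<integral>\<^sup>+z. ennreal (norm (case z of (y, t) \<Rightarrow> \<rho> y * (indicator {0..s} t * L (x - y + t *\<^sub>R b)))) \<partial>(lborel \<Otimes>\<^sub>M lborel))
        = (\<integral>\<^sup>+y. \<integral>\<^sup>+t. ennreal (norm (\<rho> y * (indicator {0..s} t * L (x - y + t *\<^sub>R b)))) \<partial>lborel \<partial>lborel)"
        by (subst lborel.nn_integral_fst[symmetric]) auto
      also have "\<dots> = (\<integral>\<^sup>+y. ennreal \<bar>\<rho> y\<bar> * P (x - y) \<partial>lborel)"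
        unfolding P_def
        by (intro nn_integral_cong, subst nn_integral_cmult[symmetric])
          (auto intro!: nn_integral_cong simp: abs_mult ennreal_mult indicator_def)
      finally show "(\<integral>\<^sup>+z. ennreal (norm (case z of (y, t) \<Rightarrow> \<rho> y * (indicator {0..s} t * L (x - y + t *\<^sub>R b)))) \<partial>(lborel \<Otimes>\<^sub>M lborel)) < \<infinity>"
        using elim(3) by simp
    qed
    have "(LINT y|lborel. \<rho> y * K (x + s *\<^sub>R b - y)) - (LINT y|lborel. \<rho> y * K (x - y))
        = (LINT y|lborel. \<rho> y * K (x + s *\<^sub>R b - y) - \<rho> y * K (x - y))"
      using elim by simp
    also have "\<dots> = (LINT y|lborel. \<rho> y * segint b L s (x - y))"
    proof (rule integral_cong_AE)
      \<comment> \<open>\<open>KL\<close> fails on a null set of \<open>z\<close>; for every fixed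
        \<open>x\<close> the substitution \<open>z = x - y\<close> maps it to a null set of
        \<open>y\<close>.\<close>
      show "AE y in lborel. \<rho> y * K (x + s *\<^sub>R b - y) - \<rho> y * K (x - y) = \<rho> y * segint b L s (x - y)"
        using AE_reflect[OF KL, of x]
      proof eventually_elim
        case (elim y)
        have "K (x + s *\<^sub>R b - y) = K (x - y + s *\<^sub>R b)" by (simp add: algebra_simps)
        then show ?case using elim by (simp flip: right_diff_distrib)
      qed
    qed measurable
    also have "\<dots> = (LINT y|lborel. LINT t|lborel. \<rho> y * (indicator {0..s} t * L (x - y + t *\<^sub>R b)))"
      by (simp add: segint_def)
    also have "\<dots> = (LINT t|lborel. LINT y|lborel. \<rho> y * (indicator {0..s} t * L (x - y + t *\<^sub>R b)))"
      by (rule lborel_pair.Fubini_integral[symmetric, OF int])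
    also have "\<dots> = segint b (\<lambda>x. LINT y|lborel. \<rho> y * L (x - y)) s x"
      unfolding segint_def
    proof (rule Bochner_Integration.integral_cong[OF refl])
      fix t :: real
      have eq: "x - y + t *\<^sub>R b = x + t *\<^sub>R b - y" for y by (simp add: algebra_simps)
      show "(LINT y|lborel. \<rho> y * (indicator {0..s} t * L (x - y + t *\<^sub>R b)))
          = indicator {0..s} t * (LINT y|lborel. \<rho> y * L (x + t *\<^sub>R b - y))"
        unfolding eq by (cases "t \<in> {0..s}") simp_all
    qed
    finally show ?case .
  qed
qed

section \<open>The kernel\<close>

text \<open>Layers of balls take the place of polar coordinates. On \<open>r < s < 2 r\<close> the
  integrand \<open>s^(-d)\<close> is at least \<open>(2 r)^(-d)\<close>, so \<open>r^(1 - d)\<close>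
  is at most \<open>2^d\<close> times its integral there. After exchanging the integrals, the volume
  of the ball of radius \<open>s\<close> cancels \<open>s^(-d)\<close> and a constant over
  \<open>0 < s < 2\<close> remains.\<close>

lemma integrable_norm_powr_ball:
  "integrable lborel (\<lambda>x::'a::euclidean_space. indicator (ball 0 1) x * norm x powr (1 - real DIM('a)))"
proof (rule integrableI_bounded)
  let ?d = "DIM('a)"
  let ?h = "\<lambda>(x::'a) s. indicator (ball 0 s) x * (indicator {0<..<2} s * ennreal (s powr (- real ?d)))"
  show "(\<lambda>x::'a. indicator (ball 0 1) x * norm x powr (1 - real ?d)) \<in> borel_measurable lborel"
    by measurable
  have ball: "indicator (ball 0 s) x = (if norm x < s then 1 else 0 :: ennreal)" for s and x :: 'a
    by (simp add: indicator_def)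
  have meas: "(\<lambda>(x, s). ?h x s) \<in> borel_measurable (lborel \<Otimes>\<^sub>M lborel)"
    unfolding ball by measurable
  have le: "ennreal (norm (indicator (ball 0 1) x * norm x powr (1 - real ?d)))
      \<le> ennreal (2 ^ ?d) * (\<integral>\<^sup>+s. ?h x s \<partial>lborel)" for x :: 'a
  proof (cases "0 < norm x \<and> norm x < 1")
    case True
    let ?r = "norm x"
    have r: "0 < ?r" using True by simp
    have "ennreal (norm (indicator (ball 0 1) x * ?r powr (1 - real ?d))) = ennreal (2 ^ ?d * ((2 * ?r) powr (- real ?d) * ?r))"
    proof -
      have "2 ^ ?d * ((2 * ?r) powr (- real ?d) * ?r) = 2 powr real ?d * 2 powr (- real ?d) * (?r powr (- real ?d) * ?r powr 1)"
        using r by (simp add: powr_mult powr_realpow)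
      also have "\<dots> = ?r powr (1 - real ?d)"
        using r by (simp only: powr_add[symmetric]) simp
      finally show ?thesis using True by simp
    qed
    also have "\<dots> = ennreal (2 ^ ?d) * (ennreal ((2 * ?r) powr (- real ?d)) * ennreal ?r)"
      by (simp add: ennreal_mult)
    also have "ennreal ((2 * ?r) powr (- real ?d)) * ennreal ?r
        = (\<integral>\<^sup>+s. ennreal ((2 * ?r) powr (- real ?d)) * indicator {?r<..<2 * ?r} s \<partial>lborel)"
      using r by (subst nn_integral_cmult) auto
    also have "\<dots> \<le> (\<integral>\<^sup>+s. ?h x s \<partial>lborel)"
    proof (rule nn_integral_mono)
      fix s
      show "ennreal ((2 * ?r) powr (- real ?d)) * indicator {?r<..<2 * ?r} s \<le> ?h x s"
      proof (cases "s \<in> {?r<..<2 * ?r}")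
        case s: True
        have "(2 * ?r) powr (- real ?d) \<le> s powr (- real ?d)"
          by (rule powr_mono2') (use s r in auto)
        then show ?thesis using s True by (simp add: ball ennreal_leI)
      qed simp
    qed
    finally show ?thesis by (simp add: mult_left_mono)
  next
    case False
    \<comment> \<open>The origin is covered because \<open>0 powr a\<close> is 0 for every
      \<open>a\<close>.\<close>
    then have eq: "indicator (ball 0 1) x * norm x powr (1 - real ?d) = 0"
      by (cases "x = 0") auto
    show ?thesis unfolding eq by simp
  qed
  have "(\<integral>\<^sup>+(x::'a). ennreal (norm (indicator (ball 0 1) x * norm x powr (1 - real ?d))) \<partial>lborel)
      \<le> (\<integral>\<^sup>+x. ennreal (2 ^ ?d) * (\<integral>\<^sup>+s. ?h x s \<partial>lborel) \<partial>lborel)"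
    by (intro nn_integral_mono le)
  also have "\<dots> = ennreal (2 ^ ?d) * (\<integral>\<^sup>+x. \<integral>\<^sup>+s. ?h x s \<partial>lborel \<partial>lborel)"
    by (rule nn_integral_cmult) (use meas in measurable)
  also have "(\<integral>\<^sup>+x. \<integral>\<^sup>+s. ?h x s \<partial>lborel \<partial>lborel) = (\<integral>\<^sup>+s. \<integral>\<^sup>+x. ?h x s \<partial>lborel \<partial>lborel)"
    by (rule lborel_pair.Fubini'[OF meas, symmetric])
  also have "\<dots> = (\<integral>\<^sup>+s. ennreal (unit_ball_vol ?d) * indicator {0<..<2::real} s \<partial>lborel)"
  proof (rule nn_integral_cong)
    fix s :: real
    have "(\<integral>\<^sup>+x. ?h x s \<partial>lborel) = emeasure lborel (ball (0::'a) s) * (indicator {0<..<2} s * ennreal (s powr (- real ?d)))"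
      by (subst nn_integral_multc) auto
    also have "\<dots> = ennreal (unit_ball_vol ?d) * indicator {0<..<2::real} s"
    proof (cases "s \<in> {0<..<2}")
      case True
      have "unit_ball_vol ?d * s ^ ?d * s powr (- real ?d) = unit_ball_vol ?d * (s powr real ?d * s powr (- real ?d))"
        using True by (simp add: powr_realpow)
      also have "\<dots> = unit_ball_vol ?d" using True by (simp flip: powr_add)
      finally show ?thesis using True
        by (simp add: emeasure_ball flip: ennreal_mult)
    qed simp
    finally show "(\<integral>\<^sup>+x. ?h x s \<partial>lborel) = ennreal (unit_ball_vol ?d) * indicator {0<..<2::real} s" .
  qed
  also have "\<dots> = ennreal (unit_ball_vol ?d) * 2"
    by (subst nn_integral_cmult) auto
  finally show "(\<integral>\<^sup>+(x::'a). ennreal (norm (indicator (ball 0 1) x * norm x powr (1 - real ?d))) \<partial>lborel) < \<infinity>"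
    by (auto elim!: le_less_trans simp: ennreal_mult_less_top)
qed

locale attractive_kernel =
  fixes W :: "'a::euclidean_space \<Rightarrow> real" and \<omega> :: "real \<Rightarrow> real"
  assumes W_C1: "C1_on (- {0}) W"
    and W_radial: "x \<noteq> 0 \<Longrightarrow> W x = \<omega> (norm x)"
    and W_bound: "\<exists>C>0. \<forall>r. 0 < r \<and> r \<le> 1 \<longrightarrow> deriv \<omega> r \<le> C * r powr (1 - real DIM('a))"
    and deriv_pos: "0 < r \<Longrightarrow> r < 1 \<Longrightarrow> deriv \<omega> r > 0"
    and zero_outside: "r \<ge> 1 \<Longrightarrow> deriv \<omega> r = 0 \<and> \<omega> r = 0"
begin

definition C where "C = (SOME C. 0 < C \<and> (\<forall>r. 0 < r \<and> r \<le> 1 \<longrightarrow> deriv \<omega> r \<le> C * r powr (1 - real DIM('a))))"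

lemma C: "0 < C" "0 < r \<Longrightarrow> r \<le> 1 \<Longrightarrow> deriv \<omega> r \<le> C * r powr (1 - real DIM('a))"
  using someI_ex[OF W_bound] unfolding C_def by blast+

lemma GDERIV_W: "x \<noteq> 0 \<Longrightarrow> GDERIV W x :> grad W x"
  using W_C1 by (intro GDERIV_grad) (auto simp: C1_on_def)

text \<open>A bound on \<open>deriv \<omega>\<close> alone does not assert that \<omega> is
  differentiable; this is inherited from \<open>W\<close> restricted to a ray.\<close>

lemma DERIV_omega: 
  assumes r: "r > 0"
  shows "(\<omega> has_real_derivative deriv \<omega> r) (at r)"
proof -
  obtain e :: 'a where e: "e \<in> Basis" using nonempty_Basis by blast
  have "((\<lambda>r. r *\<^sub>R e) has_derivative (\<lambda>h. h *\<^sub>R e)) (at r)"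
    by (auto intro!: derivative_eq_intros)
  moreover have "(W has_derivative (\<lambda>h. h \<bullet> grad W (r *\<^sub>R e))) (at (r *\<^sub>R e))"
    using GDERIV_W[of "r *\<^sub>R e"] r nonzero_Basis[OF e] by (auto simp: gderiv_def)
  ultimately have "((\<lambda>r. W (r *\<^sub>R e)) has_derivative (\<lambda>h. (h *\<^sub>R e) \<bullet> grad W (r *\<^sub>R e))) (at r)"
    by (rule has_derivative_compose)
  then have "((\<lambda>r. W (r *\<^sub>R e)) has_real_derivative (e \<bullet> grad W (r *\<^sub>R e))) (at r)"
    unfolding has_field_derivative_def by (rule has_derivative_eq_rhs) (simp add: fun_eq_iff)
  then have "(\<omega> has_real_derivative (e \<bullet> grad W (r *\<^sub>R e))) (at r)"
    by (rule has_field_derivative_transform_within_open[of _ _ _ "{0<..}"])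
      (use r nonzero_Basis[OF e] W_radial norm_Basis[OF e] in auto)
  then show ?thesis using DERIV_imp_deriv by fastforce
qed

lemma grad_W: 
  assumes x: "x \<noteq> 0"
  shows "grad W x = deriv \<omega> (norm x) *\<^sub>R sgn x"
proof (rule grad_eqI)
  have "GDERIV (\<lambda>x. \<omega> (norm x)) x :> deriv \<omega> (norm x) *\<^sub>R sgn x"
    by (rule GDERIV_DERIV_compose[OF GDERIV_norm[OF x] DERIV_omega]) (use x in simp)
  then show "GDERIV W x :> deriv \<omega> (norm x) *\<^sub>R sgn x"
    unfolding gderiv_def
    by (rule has_derivative_transform_within_open[of _ _ _ _ "- {0}"]) (use x W_radial in auto)
qed

text \<open>One integrable majorant, used for both \<open>W\<close> and its gradient.\<close>

definition bound where "bound x = C * (indicator (ball 0 1) x * norm x powr (1 - real DIM('a)))" for x :: 'a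

lemma integrable_bound: "integrable lborel bound"
  unfolding bound_def using integrable_norm_powr_ball[where 'a='a] by simp

lemma bound_nonneg: "0 \<le> bound x"
  using C(1) by (simp add: bound_def)

lemma norm_grad_W_le: 
  assumes x: "x \<noteq> 0"
  shows "norm (grad W x) \<le> bound x"
proof (cases "norm x < 1")
  case True
  then show ?thesis using x C(2)[of "norm x"] deriv_pos[of "norm x"]
    by (simp add: grad_W bound_def norm_sgn)
next
  case False
  then show ?thesis using x zero_outside[of "norm x"] bound_nonneg[of x] by (simp add: grad_W)
qed

text \<open>By the mean value theorem on \<open>[norm x, 1]\<close>, where \<omega> ends at 0,
  \<open>- W x\<close> is \<open>1 - norm x\<close> times a slope at some larger radius
  \<open>z\<close>. The slope is positive, and at most \<open>C * z powr (1 - d)\<close>, which only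
  grows when \<open>z\<close> is lowered to \<open>norm x\<close>.\<close>

lemma W_nonpos_le_bound: 
  assumes x: "x \<noteq> 0"
  shows "W x \<le> 0" "\<bar>W x\<bar> \<le> bound x"
proof -
  have "W x \<le> 0 \<and> \<bar>W x\<bar> \<le> bound x"
  proof (cases "norm x < 1")
    case True
    let ?r = "norm x"
    have r: "0 < ?r" using x by simp
    obtain z where z: "z > ?r" "z < 1" and eq: "\<omega> 1 - \<omega> ?r = (1 - ?r) * deriv \<omega> z"
      using MVT2[OF True DERIV_omega] r by (metis less_le_trans)
    have pos: "0 < deriv \<omega> z" by (rule deriv_pos) (use z r in linarith)+
    have "deriv \<omega> z \<le> C * z powr (1 - real DIM('a))" by (rule C(2)) (use z r in linarith)+
    also have "\<dots> \<le> C * ?r powr (1 - real DIM('a))"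
      using C(1) z r by (intro mult_left_mono powr_mono2') (auto simp: Suc_le_eq)
    finally have le: "deriv \<omega> z \<le> bound x" using True by (simp add: bound_def)
    have "- W x = (1 - ?r) * deriv \<omega> z" using eq x zero_outside[of 1] W_radial by simp
    moreover have "0 \<le> (1 - ?r) * deriv \<omega> z" using pos True by simp
    moreover have "(1 - ?r) * deriv \<omega> z \<le> 1 * bound x"
      by (rule mult_mono) (use le pos r True in auto)
    ultimately show ?thesis by simp
  next
    case False
    then show ?thesis using x zero_outside[of "norm x"] bound_nonneg[of x] W_radial by simp
  qed
  then show "W x \<le> 0" "\<bar>W x\<bar> \<le> bound x" by auto
qed

text \<open>The sign makes \<open>V\<close> nonnegative; \<open>DV b\<close> is its derivative in direction \<open>b\<close>. The values at the
  origin are immaterial.\<close>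

definition V where "V x = (if x = 0 then 0 else - W x)"

definition DV where "DV b x = (if x = 0 then 0 else - (grad W x \<bullet> b))"

lemma continuous_on_W: "continuous_on (- {0}) W"
  using W_C1 by (auto simp: C1_on_def intro!: continuous_at_imp_continuous_on differentiable_imp_continuous_within)

lemma measurable_V [measurable]: "V \<in> borel_measurable borel"
proof -
  have "(\<lambda>x. if x \<in> - {0} then - W x else 0) \<in> borel_measurable borel"
    by (rule borel_measurable_continuous_on_if) (auto intro!: continuous_intros continuous_on_W)
  moreover have "(\<lambda>x. if x \<in> - {0} then - W x else 0) = V" by (auto simp: V_def fun_eq_iff)
  ultimately show ?thesis by simp
qed

lemma measurable_DV [measurable]: "DV b \<in> borel_measurable borel"
proof -
  have "continuous_on (- {0}) (grad W)" using W_C1 by (simp add: C1_on_def)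
  then have "(\<lambda>x. if x \<in> - {0} then - (grad W x \<bullet> b) else 0) \<in> borel_measurable borel"
    by (intro borel_measurable_continuous_on_if) (auto intro!: continuous_intros)
  moreover have "(\<lambda>x. if x \<in> - {0} then - (grad W x \<bullet> b) else 0) = DV b" by (auto simp: DV_def fun_eq_iff)
  ultimately show ?thesis by simp
qed

lemma V_nonneg: "0 \<le> V x"
  using W_nonpos_le_bound[of x] by (simp add: V_def)

lemma integrable_V: "integrable lborel V"
  by (rule integrable_abs_le[OF integrable_bound])
    (use W_nonpos_le_bound bound_nonneg in \<open>auto simp: V_def abs_of_nonneg\<close>)

lemma integrable_DV: 
  assumes b: "norm b = 1"
  shows "integrable lborel (DV b)"
proof (rule integrable_abs_le[OF integrable_bound])
  fix x
  have "\<bar>grad W x \<bullet> b\<bar> \<le> norm (grad W x)" using Cauchy_Schwarz_ineq2[of "grad W x" b] b by simp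
  then show "\<bar>DV b x\<bar> \<le> \<bar>bound x\<bar>"
    using norm_grad_W_le[of x] bound_nonneg[of x] by (auto simp: DV_def)
qed measurable

lemma V_segment_avoiding_0:
  assumes "p \<le> q" and ne: "\<And>t. p \<le> t \<Longrightarrow> t \<le> q \<Longrightarrow> z + t *\<^sub>R b \<noteq> 0"
  shows "(LINT t|lborel. DV b (z + t *\<^sub>R b) * indicator {p..q} t) = V (z + q *\<^sub>R b) - V (z + p *\<^sub>R b)"
proof -
  have "(LINT t|lborel. - (grad W (z + t *\<^sub>R b) \<bullet> b) * indicator {p..q} t) = - W (z + q *\<^sub>R b) - - W (z + p *\<^sub>R b)"
  proof (rule integral_FTC_Icc_real[OF \<open>p \<le> q\<close>])
    fix t assume t: "p \<le> t" "t \<le> q"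
    have "((\<lambda>t. z + t *\<^sub>R b) has_derivative (\<lambda>h. h *\<^sub>R b)) (at t)"
      by (auto intro!: derivative_eq_intros)
    moreover have "(W has_derivative (\<lambda>h. h \<bullet> grad W (z + t *\<^sub>R b))) (at (z + t *\<^sub>R b))"
      using GDERIV_W[OF ne[OF t]] by (simp add: gderiv_def)
    ultimately have "((\<lambda>t. W (z + t *\<^sub>R b)) has_derivative (\<lambda>h. (h *\<^sub>R b) \<bullet> grad W (z + t *\<^sub>R b))) (at t)"
      by (rule has_derivative_compose)
    then have "((\<lambda>t. W (z + t *\<^sub>R b)) has_real_derivative (grad W (z + t *\<^sub>R b) \<bullet> b)) (at t)"
      unfolding has_field_derivative_def by (rule has_derivative_eq_rhs) (simp add: fun_eq_iff inner_commute)
    then show "((\<lambda>t. - W (z + t *\<^sub>R b)) has_real_derivative - (grad W (z + t *\<^sub>R b) \<bullet> b)) (at t)"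
      by (rule DERIV_minus)
    have "continuous_on (- {0}) (grad W)" using W_C1 by (simp add: C1_on_def)
    then have "isCont (grad W) (z + t *\<^sub>R b)"
      using ne[OF t] continuous_on_eq_continuous_at[of "- {0}" "grad W"] by (simp add: open_Compl)
    then have "isCont (\<lambda>t. grad W (z + t *\<^sub>R b)) t"
      by (rule isCont_o2[where f="\<lambda>t. z + t *\<^sub>R b", rotated]) (auto intro!: continuous_intros)
    then show "isCont (\<lambda>t. - (grad W (z + t *\<^sub>R b) \<bullet> b)) t"
      by (intro continuous_minus continuous_inner continuous_const)
  qed
  moreover have "DV b (z + t *\<^sub>R b) * indicator {p..q} t = - (grad W (z + t *\<^sub>R b) \<bullet> b) * indicator {p..q} t" for t
    using ne[of t] by (auto simp: DV_def indicator_def)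
  ultimately show ?thesis using ne[of p] ne[of q] \<open>p \<le> q\<close> by (simp add: V_def)
qed

text \<open>If the segment passes through the origin, the contributions of the two ends of a symmetric
  gap around the origin cancel because \<open>W\<close> is even.\<close>

lemma V_segment:
  assumes b: "norm b = 1" and s: "0 \<le> s"
  shows "AE z in lborel. V (z + s *\<^sub>R b) - V z = segint b (DV b) s z"
proof -
  have "AE z in lborel. z \<noteq> (0::'a)" by (rule AE_lborel_singleton)
  \<comment> \<open>For fixed \<open>s\<close>, segments starting or ending at the origin belong to
    a null set of \<open>z\<close>; from here on the origin can only be an interior point.\<close>
  moreover from AE_shift[OF this, of "s *\<^sub>R b"] have "AE z in lborel. z + s *\<^sub>R b \<noteq> 0" .
  moreover note AE_integrable_segment[OF integrable_imp_loc_integrable[OF integrable_DV[OF b]] b]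
  ultimately show ?thesis
  proof eventually_elim
    case (elim z)
    have seg: "segint b (DV b) s z = (LINT t|lborel. DV b (z + t *\<^sub>R b) * indicator {0..s} t)"
      by (simp add: segint_def mult.commute)
    show ?case
    proof (cases "\<exists>t\<ge>0. t \<le> s \<and> z + t *\<^sub>R b = 0")
      case False
      then show ?thesis using V_segment_avoiding_0[OF s, of z b] by (auto simp: seg)
    next
      case True
      \<comment> \<open>In dimension one the lines through the origin are not exceptional, so this
        case cannot be discarded as a null set.\<close>
      then obtain t0 where t0: "0 \<le> t0" "t0 \<le> s" "z + t0 *\<^sub>R b = 0" by blast
      have z: "z = - t0 *\<^sub>R b" using t0(3) by (simp add: eq_neg_iff_add_eq_0)
      have "t0 \<noteq> 0" "t0 \<noteq> s" using elim t0 by auto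
      then have t0': "0 < t0" "t0 < s" using t0 by auto
      have line: "z + t *\<^sub>R b = (t - t0) *\<^sub>R b" for t by (simp add: z algebra_simps)
      \<comment> \<open>Half the width of the largest gap symmetric about \<open>t0\<close> that
        fits into the segment; \<open>\<delta> n\<close> shrinks it to a point. Integrability of
        \<open>DV b\<close> on this line makes the contribution of the gap disappear in the
        limit.\<close>
      define c where "c = min t0 (s - t0)"
      define \<delta> where "\<delta> n = c / (real n + 1)" for n :: nat
      have c: "0 < c" "c \<le> t0" "c \<le> s - t0" using t0' by (auto simp: c_def)
      have \<delta>: "0 < \<delta> n" "\<delta> n \<le> c" for n using c by (auto simp: \<delta>_def field_simps)
      have \<delta>0: "\<delta> \<longlonglongrightarrow> 0" unfolding \<delta>_def using LIMSEQ_Suc[OF lim_const_over_n[of c]] by (simp add: add.commute)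
      have int: "integrable lborel (\<lambda>t. DV b (z + t *\<^sub>R b) * indicator {0..s} t)"
        using elim(3) by (simp add: mult.commute)
      let ?J = "\<lambda>n. {0..t0 - \<delta> n} \<union> {t0 + \<delta> n..s}"
      have sub: "\<bar>DV b (z + t *\<^sub>R b) * indicator A t\<bar> \<le> \<bar>DV b (z + t *\<^sub>R b) * indicator {0..s} t\<bar>"
        if "A \<subseteq> {0..s}" for A t using that by (auto simp: indicator_def)
      have val: "(LINT t|lborel. DV b (z + t *\<^sub>R b) * indicator (?J n) t) = V (z + s *\<^sub>R b) - V z" for n
      proof -
        have i1: "integrable lborel (\<lambda>t. DV b (z + t *\<^sub>R b) * indicator {0..t0 - \<delta> n} t)"
          by (rule integrable_abs_le[OF int], measurable, rule sub) (use c \<delta>[of n] in auto)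
        have i2: "integrable lborel (\<lambda>t. DV b (z + t *\<^sub>R b) * indicator {t0 + \<delta> n..s} t)"
          by (rule integrable_abs_le[OF int], measurable, rule sub) (use c \<delta>[of n] in auto)
        have "(LINT t|lborel. DV b (z + t *\<^sub>R b) * indicator (?J n) t)
          = (LINT t|lborel. DV b (z + t *\<^sub>R b) * indicator {0..t0 - \<delta> n} t + DV b (z + t *\<^sub>R b) * indicator {t0 + \<delta> n..s} t)"
          by (intro Bochner_Integration.integral_cong) (use \<delta>(1)[of n] in \<open>auto simp: indicator_def\<close>)
        also have "\<dots> = (LINT t|lborel. DV b (z + t *\<^sub>R b) * indicator {0..t0 - \<delta> n} t)
          + (LINT t|lborel. DV b (z + t *\<^sub>R b) * indicator {t0 + \<delta> n..s} t)"
          using i1 i2 by (rule Bochner_Integration.integral_add)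
        also have "(LINT t|lborel. DV b (z + t *\<^sub>R b) * indicator {0..t0 - \<delta> n} t)
           = V (z + (t0 - \<delta> n) *\<^sub>R b) - V (z + 0 *\<^sub>R b)"
          by (rule V_segment_avoiding_0) (use c \<delta>[of n] b in \<open>auto simp: line\<close>)
        also have "(LINT t|lborel. DV b (z + t *\<^sub>R b) * indicator {t0 + \<delta> n..s} t)
           = V (z + s *\<^sub>R b) - V (z + (t0 + \<delta> n) *\<^sub>R b)"
          by (rule V_segment_avoiding_0) (use c \<delta>[of n] b in \<open>auto simp: line\<close>)
        also have "V (z + (t0 - \<delta> n) *\<^sub>R b) = V (z + (t0 + \<delta> n) *\<^sub>R b)"
          using b \<delta>(1)[of n] by (auto simp: line V_def W_radial)
        finally show ?thesis by simp
      qed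
      have "(\<lambda>n. LINT t|lborel. DV b (z + t *\<^sub>R b) * indicator (?J n) t)
          \<longlonglongrightarrow> (LINT t|lborel. DV b (z + t *\<^sub>R b) * indicator {0..s} t)"
      proof (rule integral_dominated_convergence)
        show "integrable lborel (\<lambda>t. norm (DV b (z + t *\<^sub>R b) * indicator {0..s} t))"
          using int by (rule integrable_norm)
        show "AE t in lborel. (\<lambda>n. DV b (z + t *\<^sub>R b) * indicator (?J n) t)
            \<longlonglongrightarrow> DV b (z + t *\<^sub>R b) * indicator {0..s} t"
          using AE_lborel_singleton[of t0]
        proof eventually_elim
          case (elim t)
          have "\<forall>\<^sub>F n in sequentially. \<delta> n < \<bar>t - t0\<bar>"
            by (rule order_tendstoD(2)[OF \<delta>0]) (use elim in simp)
          then have "\<forall>\<^sub>F n in sequentially. DV b (z + t *\<^sub>R b) * indicator (?J n) t = DV b (z + t *\<^sub>R b) * indicator {0..s} t"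
          proof eventually_elim
            case (elim n)
            have "t \<in> ?J n \<longleftrightarrow> t \<in> {0..s}" using elim \<delta>[of n] c by (auto simp: abs_if split: if_splits)
            then show ?case by (simp add: indicator_def)
          qed
          then show ?case by (rule tendsto_eventually)
        qed
        show "AE t in lborel. norm (DV b (z + t *\<^sub>R b) * indicator (?J n) t)
            \<le> norm (DV b (z + t *\<^sub>R b) * indicator {0..s} t)" for n
          using sub[of "?J n"] c \<delta>[of n] by (intro AE_I2) auto
      qed measurable
      then show ?thesis unfolding seg val by (simp add: LIMSEQ_const_iff)
    qed
  qed
qed

end

section \<open>Iteration of moments\<close>

text \<open>Multiplied by \<open>p\<close>, this says that the convex function
  \<open>t powr p\<close> lies above its tangent at \<open>s\<close>.\<close>

lemma Youngs_powr:
  fixes p s t :: real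
  assumes "1 \<le> p" "0 \<le> s" "0 \<le> t"
  shows "s powr (p - 1) * t \<le> (1 - 1 / p) * s powr p + t powr p / p"
proof (cases "s = 0 \<or> t = 0")
  case True
  then show ?thesis using assms by auto
next
  case False
  have "(s powr p) powr (1 - 1 / p) * (t powr p) powr (1 / p) \<le> (1 - 1 / p) * s powr p + 1 / p * t powr p"
    by (rule Youngs_inequality_0) (use False assms in auto)
  moreover have "p * (1 - 1 / p) = p - 1" using assms by (simp add: field_simps)
  ultimately show ?thesis using False assms by (simp add: powr_powr)
qed

text \<open>Jensen's inequality: the tangent inequality at the mean \<open>a\<close> is integrated
  against the probability density \<open>k\<close>, and the resulting term
  \<open>(1 - 1 / p) * a powr p\<close> is absorbed on the left.\<close>

lemma powr_conv_le:
  fixes u k :: "'a \<Rightarrow> real"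
  assumes p: "1 \<le> p" and u: "\<And>y. 0 \<le> u y" and k: "\<And>y. 0 \<le> k y"
    and ik: "integrable M k" and k1: "(LINT y|M. k y) = 1"
    and i1: "integrable M (\<lambda>y. u y * k y)" and ip: "integrable M (\<lambda>y. u y powr p * k y)"
  shows "(LINT y|M. u y * k y) powr p \<le> (LINT y|M. u y powr p * k y)"
proof -
  define a where "a = (LINT y|M. u y * k y)"
  have a: "0 \<le> a" unfolding a_def using u k by (intro integral_nonneg_AE) auto
  have "a powr (p - 1) * a = (LINT y|M. a powr (p - 1) * (u y * k y))"
    unfolding a_def using i1 by simp
  also have "\<dots> \<le> (LINT y|M. (1 - 1 / p) * a powr p * k y + 1 / p * (u y powr p * k y))"
  proof (rule integral_mono)
    fix y
    have "a powr (p - 1) * u y * k y \<le> ((1 - 1 / p) * a powr p + u y powr p / p) * k y"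
      by (intro mult_right_mono Youngs_powr p a u k)
    then show "a powr (p - 1) * (u y * k y) \<le> (1 - 1 / p) * a powr p * k y + 1 / p * (u y powr p * k y)"
      by (simp add: algebra_simps)
  qed (use i1 ip ik in auto)
  also have "\<dots> = (1 - 1 / p) * a powr p + 1 / p * (LINT y|M. u y powr p * k y)"
    using i1 ip ik k1 by simp
  finally have "a powr (p - 1) * a \<le> (1 - 1 / p) * a powr p + 1 / p * (LINT y|M. u y powr p * k y)" .
  moreover have "a powr (p - 1) * a = a powr p" 
    using a by (cases "a = 0") (auto simp: powr_diff)
  ultimately show ?thesis using p unfolding a_def by (simp add: field_simps)
qed

lemma integral_reflect:
  fixes f :: "'a::euclidean_space \<Rightarrow> real"
  assumes "f \<in> borel_measurable borel"
  shows "(LINT y|lborel. f (x - y)) = (LINT y|lborel. f y)"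
  using integral_distr[of "(\<lambda>y. x - y)" lborel borel f] assms by (simp add: lborel_distr_reflect)

lemma integrable_reflect:
  fixes f :: "'a::euclidean_space \<Rightarrow> real"
  assumes "integrable lborel f"
  shows "integrable lborel (\<lambda>y. f (x - y))"
  using integrable_distr_eq[of "(\<lambda>y. x - y)" lborel borel f] assms by (simp add: lborel_distr_reflect)

text \<open>Raise the hypothesis to the power \<open>p\<close>, apply Jensen's inequality, then
  Tonelli: convolution with a density of mass one preserves the integral of \<open>u powr p\<close>.
  Finiteness passes to the new moment, so the step can be iterated from integrability of
  \<open>u\<close> alone.\<close>

lemma moment_step:
  fixes u k :: "'a::euclidean_space \<Rightarrow> real"
  assumes u: "\<And>x. 0 \<le> u x" "integrable lborel u" and k: "\<And>x. 0 \<le> k x" "integrable lborel k"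
    and k1: "(LINT x|lborel. k x) = 1" and p: "1 \<le> p"
    and le: "AE x in lborel. u x powr \<alpha> \<le> (LINT y|lborel. u y * k (x - y))"
    and fin: "(\<integral>\<^sup>+x. ennreal (u x powr p) \<partial>lborel) < \<infinity>"
  shows "(\<integral>\<^sup>+x. ennreal (u x powr (\<alpha> * p)) \<partial>lborel) \<le> (\<integral>\<^sup>+x. ennreal (u x powr p) \<partial>lborel)"
proof -
  have [measurable]: "u \<in> borel_measurable borel" "k \<in> borel_measurable borel" using u k by auto
  have up: "integrable lborel (\<lambda>x. u x powr p)"
    by (rule integrableI_bounded) (use fin in auto)
  have "AE x in lborel. ennreal (u x powr (\<alpha> * p)) \<le> (\<integral>\<^sup>+y. ennreal (u y powr p) * ennreal (k (x - y)) \<partial>lborel)"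
    using le lborel_pair.AE_integrable_fst[OF integrable_conv_pair[OF u(2) k(2)]]
      lborel_pair.AE_integrable_fst[OF integrable_conv_pair[OF up k(2)]]
  proof eventually_elim
    case (elim x)
    have "u x powr (\<alpha> * p) = (u x powr \<alpha>) powr p" by (simp add: powr_powr)
    also have "\<dots> \<le> (LINT y|lborel. u y * k (x - y)) powr p"
      using elim(1) p by (intro powr_mono2) auto
    also have "\<dots> \<le> (LINT y|lborel. u y powr p * k (x - y))"
      by (rule powr_conv_le[OF p]) (use u k elim k1 in \<open>auto simp: integral_reflect intro: integrable_reflect\<close>)
    finally have "ennreal (u x powr (\<alpha> * p)) \<le> ennreal (LINT y|lborel. u y powr p * k (x - y))"
      by (rule ennreal_leI)
    also have "\<dots> = (\<integral>\<^sup>+y. ennreal (u y powr p * k (x - y)) \<partial>lborel)"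
      by (rule nn_integral_eq_integral[symmetric]) (use elim k in auto)
    also have "\<dots> = (\<integral>\<^sup>+y. ennreal (u y powr p) * ennreal (k (x - y)) \<partial>lborel)"
      using k by (simp add: ennreal_mult)
    finally show ?case .
  qed
  then have "(\<integral>\<^sup>+x. ennreal (u x powr (\<alpha> * p)) \<partial>lborel)
      \<le> (\<integral>\<^sup>+x. \<integral>\<^sup>+y. ennreal (u y powr p) * ennreal (k (x - y)) \<partial>lborel \<partial>lborel)"
    by (rule nn_integral_mono_AE)
  also have "\<dots> = (\<integral>\<^sup>+x. ennreal (u x powr p) \<partial>lborel) * (\<integral>\<^sup>+x. ennreal (k x) \<partial>lborel)"
    by (rule nn_integral_conv) measurable
  also have "(\<integral>\<^sup>+x. ennreal (k x) \<partial>lborel) = 1"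
    using nn_integral_eq_integral[OF k(2)] k(1) k1 by simp
  finally show ?thesis by simp
qed

text \<open>Markov's inequality on the set where \<open>u \<ge> l\<close>, with
  \<open>l > 1\<close>: its measure times \<open>l powr (\<alpha> ^ n)\<close> is at most the first
  moment \<open>B\<close> for every \<open>n\<close>, which forces measure 0.\<close>

lemma AE_le_1_of_conv_bound:
  fixes u k :: "'a::euclidean_space \<Rightarrow> real"
  assumes u: "\<And>x. 0 \<le> u x" "integrable lborel u" and k: "\<And>x. 0 \<le> k x" "integrable lborel k"
    and k1: "(LINT x|lborel. k x) = 1" and \<alpha>: "1 < \<alpha>"
    and le: "AE x in lborel. u x powr \<alpha> \<le> (LINT y|lborel. u y * k (x - y))"
  shows "AE x in lborel. u x \<le> 1"
proof -
  have [measurable]: "u \<in> borel_measurable borel" using u by auto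
  define B where "B = (LINT x|lborel. u x)"
  have B: "(\<integral>\<^sup>+x. ennreal (u x) \<partial>lborel) = ennreal B"
    unfolding B_def using nn_integral_eq_integral[OF u(2)] u(1) by simp
  have B0: "0 \<le> B" unfolding B_def using u(1) by (intro integral_nonneg_AE) auto
  have moment: "(\<integral>\<^sup>+x. ennreal (u x powr (\<alpha> ^ n)) \<partial>lborel) \<le> ennreal B" for n
  proof (induction n)
    case 0
    then show ?case using u(1) B by simp
  next
    case (Suc n)
    have "(\<integral>\<^sup>+x. ennreal (u x powr (\<alpha> * \<alpha> ^ n)) \<partial>lborel) \<le> (\<integral>\<^sup>+x. ennreal (u x powr (\<alpha> ^ n)) \<partial>lborel)"
      using Suc \<alpha> by (intro moment_step[OF u k k1 _ le]) (auto elim!: le_less_trans)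
    then show ?case using Suc by simp
  qed
  have "AE x in lborel. u x < l" if l: "1 < l" for l
  proof -
    let ?A = "{x. l \<le> u x}"
    have mk: "ennreal (l powr (\<alpha> ^ n)) * emeasure lborel ?A \<le> ennreal B" for n
    proof -
      have "ennreal (l powr (\<alpha> ^ n)) * emeasure lborel ?A = (\<integral>\<^sup>+x. ennreal (l powr (\<alpha> ^ n)) * indicator ?A x \<partial>lborel)"
        by (rule nn_integral_cmult_indicator[symmetric]) simp
      also have "\<dots> \<le> (\<integral>\<^sup>+x. ennreal (u x powr (\<alpha> ^ n)) \<partial>lborel)"
        using l \<alpha> by (intro nn_integral_mono) (auto simp: indicator_def intro!: ennreal_leI powr_mono2)
      finally show ?thesis using moment[of n] by order
    qed
    \<comment> \<open>Markov's inequality for \<open>n = 0\<close>; a finite measure allows the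
      computation to continue in the reals.\<close>
    have "emeasure lborel ?A < \<infinity>"
    proof -
      have "1 * emeasure lborel ?A \<le> ennreal (l powr (\<alpha> ^ 0)) * emeasure lborel ?A"
        using l by (intro mult_right_mono) auto
      also have "\<dots> < \<infinity>" using mk[of 0] by (auto elim!: le_less_trans)
      finally show ?thesis by simp
    qed
    then obtain e where e: "emeasure lborel ?A = ennreal e" "0 \<le> e"
      by (metis enn2real_nonneg ennreal_enn2real infinity_ennreal_def)
    have "e = 0"
    proof (rule ccontr)
      assume "e \<noteq> 0"
      then have e0: "0 < e" using e by simp
      have le: "l powr (\<alpha> ^ n) * e \<le> B" for n
        using mk[of n] e B0 by (simp flip: ennreal_mult)
      have ln: "0 < ln l" using l by simp
      \<comment> \<open>Because \<open>exp y \<ge> y\<close>, it is enough that the exponent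
        \<open>\<alpha> ^ n * ln l\<close> itself exceeds \<open>B / e\<close>.\<close>
      obtain n where n: "B / (e * ln l) < \<alpha> ^ n"
        using real_arch_pow[OF \<alpha>] by blast
      have "\<alpha> ^ n * ln l \<le> exp (\<alpha> ^ n * ln l)" using exp_ge_add_one_self[of "\<alpha> ^ n * ln l"] by linarith
      also have "\<dots> = l powr (\<alpha> ^ n)" using l by (simp add: powr_def)
      finally have "\<alpha> ^ n * ln l * e \<le> l powr (\<alpha> ^ n) * e" using e0 by (intro mult_right_mono) auto
      then have "\<alpha> ^ n * ln l * e \<le> B" using le[of n] by linarith
      moreover have "B < \<alpha> ^ n * (e * ln l)" using n ln e0 by (simp add: pos_divide_less_eq)
      ultimately show False by (simp add: mult_ac)
    qed
    then have "?A \<in> null_sets lborel" using e by (auto intro!: null_setsI)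
    from AE_not_in[OF this] show ?thesis by eventually_elim auto
  qed
  then have "AE x in lborel. u x < 1 + 1 / (real n + 1)" for n :: nat by simp
  then have "AE x in lborel. \<forall>n::nat. u x < 1 + 1 / (real n + 1)"
    by (intro AE_all_countable[THEN iffD2] allI)
  then show ?thesis
  proof eventually_elim
    case (elim x)
    show ?case
    proof (rule ccontr)
      assume "\<not> u x \<le> 1"
      then have "0 < u x - 1" by simp
      then obtain n where "inverse (real (Suc n)) < u x - 1" using reals_Archimedean by blast
      then show False using elim[rule_format, of n] by (simp add: inverse_eq_divide add.commute)
    qed
  qed
qed

section \<open>The pressure equation on a line\<close>

lemma abs_integral_le_AE:
  fixes f g :: "'a \<Rightarrow> real"
  assumes "integrable M f" "integrable M g" "AE x in M. \<bar>f x\<bar> \<le> g x"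
  shows "\<bar>LINT x|M. f x\<bar> \<le> (LINT x|M. g x)"
proof -
  have "\<bar>LINT x|M. f x\<bar> \<le> (LINT x|M. \<bar>f x\<bar>)" by (rule integral_abs_bound)
  also have "\<dots> \<le> (LINT x|M. g x)" using assms by (intro integral_mono_AE integrable_abs)
  finally show ?thesis .
qed

text \<open>Uniform continuity supplies one step length for the whole interval, so finitely many
  equal steps do the work of a supremum argument. It serves both to add up error estimates and to
  continue positivity.\<close>

lemma small_step_induct:
  fixes p q \<delta> :: real
  assumes pq: "p \<le> q" and \<delta>: "0 < \<delta>" and base: "P p"
    and step: "\<And>s t. p \<le> s \<Longrightarrow> s \<le> t \<Longrightarrow> t \<le> q \<Longrightarrow> t - s < \<delta> \<Longrightarrow> P s \<Longrightarrow> P t"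
  shows "P q"
proof -
  obtain N :: nat where N: "(q - p) / \<delta> < real N" using reals_Archimedean2 by blast
  moreover have "0 \<le> (q - p) / \<delta>" using pq \<delta> by simp
  ultimately have N0: "0 < real N" by linarith
  define h where "h = (q - p) / real N"
  have h: "0 \<le> h" "h < \<delta>" "real N * h = q - p"
    using pq N N0 \<delta> by (auto simp: h_def field_simps)
  have "i \<le> N \<Longrightarrow> P (p + real i * h)" for i
  proof (induction i)
    case 0
    then show ?case using base by simp
  next
    case (Suc i)
    have "real (Suc i) * h \<le> real N * h" using Suc.prems h by (intro mult_right_mono) auto
    then have "p + real (Suc i) * h \<le> q" using h by simp
    then show ?case
      by (intro step[OF _ _ _ _ Suc.IH]) (use Suc.prems h in \<open>auto simp: algebra_simps\<close>)
  qed
  from this[of N] show ?thesis using h by simp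
qed

lemma AE_nonneg_imp_nonneg:
  fixes f :: "real \<Rightarrow> real"
  assumes cont: "\<And>q. 0 \<le> q \<Longrightarrow> continuous_on {0..q} f"
    and ae: "AE t in lborel. 0 \<le> t \<longrightarrow> 0 \<le> f t" and t: "0 \<le> t"
  shows "0 \<le> f t"
proof (rule ccontr)
  assume neg: "\<not> 0 \<le> f t"
  \<comment> \<open>A unit of room to the right of \<open>t\<close> gives an interval of positive
    length inside the half-line, even for \<open>t = 0\<close>.\<close>
  have "continuous_on {0..t + 1} f" using cont t by simp
  then obtain \<delta> where \<delta>: "0 < \<delta>" "\<And>u. u \<in> {0..t + 1} \<Longrightarrow> dist u t < \<delta> \<Longrightarrow> dist (f u) (f t) < - f t"
    unfolding continuous_on_iff using neg t by (metis atLeastAtMost_iff add_increasing2 le_add_same_cancel1 neg_0_less_iff_less not_le zero_le_one)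
  define \<eta> where "\<eta> = min \<delta> 1"
  have \<eta>: "0 < \<eta>" "\<eta> \<le> \<delta>" "\<eta> \<le> 1" using \<delta>(1) by (auto simp: \<eta>_def)
  have lt: "f u < 0" if "u \<in> {t<..<t + \<eta>}" for u
    using \<delta>(2)[of u] that t \<eta> by (auto simp: dist_real_def)
  from ae have "AE u in lborel. u \<notin> {t<..<t + \<eta>}"
    by eventually_elim (use t lt in force)
  then have "{t<..<t + \<eta>} \<in> null_sets lborel"
    by (subst AE_iff_null_sets) auto
  then have "emeasure lborel {t<..<t + \<eta>} = 0" by (rule null_setsD1)
  then show False using \<eta>(1) by simp
qed

text \<open>\<open>segint\<close> with the base point and direction fixed, regarded as a function of
  the length.\<close>

definition prim :: "(real \<Rightarrow> real) \<Rightarrow> real \<Rightarrow> real" where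
  "prim f s = (LINT t|lborel. indicator {0..s} t * f t)"

lemma prim_0: "prim f 0 = 0"
proof -
  have "AE t in lborel. indicator {0..0} t * f t = 0"
    using AE_lborel_singleton[of 0] by eventually_elim simp
  then show ?thesis unfolding prim_def by (rule integral_eq_zero_AE)
qed

lemma prim_diff:
  assumes int: "\<And>s. integrable lborel (\<lambda>t. indicator {0..s} t * f t)" and st: "0 \<le> s" "s \<le> t"
  shows "integrable lborel (\<lambda>r. indicator {s<..t} r * f r)"
    "prim f t - prim f s = (LINT r|lborel. indicator {s<..t} r * f r)"
proof -
  have eq: "(\<lambda>r. indicator {0..t} r * f r - indicator {0..s} r * f r) = (\<lambda>r. indicator {s<..t} r * f r)"
    using st by (auto simp: fun_eq_iff indicator_def)
  show "integrable lborel (\<lambda>r. indicator {s<..t} r * f r)"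
    using Bochner_Integration.integrable_diff[OF int[of t] int[of s]] unfolding eq .
  show "prim f t - prim f s = (LINT r|lborel. indicator {s<..t} r * f r)"
    unfolding prim_def using Bochner_Integration.integral_diff[OF int[of t] int[of s]] unfolding eq by simp
qed

lemma continuous_on_prim:
  assumes int: "\<And>s. integrable lborel (\<lambda>t. indicator {0..s} t * f t)"
  shows "continuous_on {0..q} (prim f)"
proof -
  have si: "set_integrable lborel {0..s} f" for s
    using int[of s] by (simp add: set_integrable_def)
  have "prim f s = integral {0..s} f" for s
    using set_borel_integral_eq_integral(2)[OF si[of s]] by (simp add: prim_def set_lebesgue_integral_def)
  moreover have "continuous_on {0..q} (\<lambda>s. integral {0..s} f)"
    using set_borel_integral_eq_integral(1)[OF si[of q]] by (rule indefinite_integral_continuous_1)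
  ultimately show ?thesis by (simp add: fun_eq_iff[symmetric])
qed

text \<open>The weighted arithmetic-geometric mean inequality, divided by
  \<open>x powr (1 - \<theta>)\<close>.\<close>

lemma powr_le_tangent:
  fixes \<theta> x y :: real
  assumes \<theta>: "0 < \<theta>" "\<theta> < 1" and xy: "0 < x" "0 < y"
  shows "y powr \<theta> \<le> x powr \<theta> + \<theta> * x powr (\<theta> - 1) * (y - x)"
proof -
  have "y powr \<theta> * x powr (1 - \<theta>) \<le> \<theta> * y + (1 - \<theta>) * x"
    by (rule Youngs_inequality_0) (use assms in auto)
  then have "x powr (\<theta> - 1) * (y powr \<theta> * x powr (1 - \<theta>)) \<le> x powr (\<theta> - 1) * (\<theta> * y + (1 - \<theta>) * x)"
    by (intro mult_left_mono) auto
  moreover have "x powr (\<theta> - 1) * (y powr \<theta> * x powr (1 - \<theta>)) = y powr \<theta> * x powr ((\<theta> - 1) + (1 - \<theta>))"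
    unfolding powr_add by simp
  moreover have "x powr (\<theta> - 1) * x = x powr \<theta>"
    using xy powr_add[of x "\<theta> - 1" 1] by simp
  ultimately show ?thesis using xy by (simp add: algebra_simps)
qed

text \<open>The tangent inequality bounds the increments of the concave power from both sides by the
  derivative at either end point, so the chain rule is needed neither for \<open>prim\<close> nor for \<open>powr\<close>.\<close>

lemma pressure_const:
  fixes H G r :: "real \<Rightarrow> real"
  assumes eps: "\<epsilon> > 0" and m: "m > 1"
    and iG: "\<And>s. integrable lborel (\<lambda>t. indicator {0..s} t * G t)"
    and iH: "\<And>s. integrable lborel (\<lambda>t. indicator {0..s} t * H t)"
    and ae: "AE t in lborel. 0 \<le> t \<longrightarrow> 0 \<le> r t \<and> r t powr m = v0 + prim G t \<and> G t = r t * H t / \<epsilon>"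
    and pq: "0 \<le> p" "p \<le> q" and pos: "\<And>t. p \<le> t \<Longrightarrow> t \<le> q \<Longrightarrow> 0 < v0 + prim G t"
  shows "\<epsilon> * m / (m - 1) * (v0 + prim G q) powr ((m - 1) / m) - prim H q
    = \<epsilon> * m / (m - 1) * (v0 + prim G p) powr ((m - 1) / m) - prim H p"
proof -
  \<comment> \<open>In terms of \<open>V\<close>, which is \<open>r powr m\<close> almost
    everywhere, the pressure is \<open>c * V powr \<theta>\<close>. Its derivative in
    \<open>V\<close> is \<open>h'\<close>, because \<open>c * \<theta> = \<epsilon>\<close>.\<close>
  define c where "c = \<epsilon> * m / (m - 1)"
  define \<theta> where "\<theta> = (m - 1) / m"
  define V where "V t = v0 + prim G t" for t
  define h' where "h' y = \<epsilon> * y powr (\<theta> - 1)" for y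
  define D where "D t = c * V t powr \<theta> - prim H t" for t
  \<comment> \<open>The total variation of \<open>V\<close> from 0: errors measured by increments of
    \<open>L\<close> add up over consecutive steps.\<close>
  define L where "L = prim (\<lambda>t. \<bar>G t\<bar>)"
  have iL: "integrable lborel (\<lambda>t. indicator {0..s} t * \<bar>G t\<bar>)" for s
    using integrable_abs[OF iG[of s]] by (simp add: abs_mult)
  have c\<theta>: "c * \<theta> = \<epsilon>" "0 < c" "0 < \<theta>" "\<theta> < 1" "\<theta> - 1 = - 1 / m"
    using m eps by (auto simp: c_def \<theta>_def field_simps)
  have posV: "0 < V t" if "p \<le> t" "t \<le> q" for t using pos that by (simp add: V_def)
  have tangent: "c * y powr \<theta> - c * x powr \<theta> \<le> h' x * (y - x)" if "0 < x" "0 < y" for x y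
  proof -
    have "c * (y powr \<theta>) \<le> c * (x powr \<theta> + \<theta> * x powr (\<theta> - 1) * (y - x))"
      using c\<theta> that by (intro mult_left_mono powr_le_tangent) auto
    also have "\<dots> = c * x powr \<theta> + (c * \<theta>) * x powr (\<theta> - 1) * (y - x)" by (simp add: algebra_simps)
    finally show ?thesis by (simp add: c\<theta>(1) h'_def)
  qed
  have contV: "continuous_on {p..q} V"
    unfolding V_def using continuous_on_prim[OF iG, of q] pq
    by (intro continuous_intros) (auto elim!: continuous_on_subset)
  then have conth: "continuous_on {p..q} (\<lambda>t. h' (V t))"
    unfolding h'_def using posV by (intro continuous_intros) force+
  have small: "\<bar>D q - D p\<bar> \<le> \<eta> * (L q - L p)" if \<eta>: "0 < \<eta>" for \<eta>
  proof -
    have "uniformly_continuous_on {p..q} (\<lambda>t. h' (V t))"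
      using conth by (intro compact_uniformly_continuous) auto
    then obtain \<delta> where \<delta>: "0 < \<delta>"
      and uc: "\<And>s t. s \<in> {p..q} \<Longrightarrow> t \<in> {p..q} \<Longrightarrow> dist t s < \<delta> \<Longrightarrow> dist (h' (V t)) (h' (V s)) < \<eta>"
      unfolding uniformly_continuous_on_def using \<eta> by metis
    have inc: "\<bar>D t - D s\<bar> \<le> \<eta> * (L t - L s)" if st: "p \<le> s" "s \<le> t" "t \<le> q" "t - s < \<delta>" for s t
    proof -
      have s0: "0 \<le> s" using pq st by simp
      note dG = prim_diff[OF iG s0 st(2)] and dH = prim_diff[OF iH s0 st(2)] and dL = prim_diff[OF iL s0 st(2)]
      \<comment> \<open>The slope is frozen at one point \<open>a\<close> of the step. Since
        \<open>H = h' (V u) * G\<close> almost everywhere, the error is the integral of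
        \<open>(h' (V a) - h' (V u)) * G\<close>, and the difference of slopes is below
        \<open>\<eta>\<close> within distance \<open>\<delta>\<close>.\<close>
      have key: "\<bar>h' (V a) * (V t - V s) - (prim H t - prim H s)\<bar> \<le> \<eta> * (L t - L s)"
        if a: "a \<in> {s..t}" for a
      proof -
        have "h' (V a) * (V t - V s) - (prim H t - prim H s)
          = (LINT u|lborel. h' (V a) * (indicator {s<..t} u * G u) - indicator {s<..t} u * H u)"
          using dG dH by (simp add: V_def)
        also have "\<bar>LINT u|lborel. h' (V a) * (indicator {s<..t} u * G u) - indicator {s<..t} u * H u\<bar>
          \<le> (LINT u|lborel. \<eta> * (indicator {s<..t} u * \<bar>G u\<bar>))"
        proof (rule abs_integral_le_AE)
          show "integrable lborel (\<lambda>u. h' (V a) * (indicator {s<..t} u * G u) - indicator {s<..t} u * H u)"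
            using dG dH by auto
          show "integrable lborel (\<lambda>u. \<eta> * (indicator {s<..t} u * \<bar>G u\<bar>))"
            using dL by auto
          show "AE u in lborel. \<bar>h' (V a) * (indicator {s<..t} u * G u) - indicator {s<..t} u * H u\<bar>
              \<le> \<eta> * (indicator {s<..t} u * \<bar>G u\<bar>)"
            using ae
          proof eventually_elim
            case (elim u)
            show ?case
            proof (cases "u \<in> {s<..t}")
              case True
              then have u: "p \<le> u" "u \<le> q" "0 \<le> u" using st pq by auto
              then have r: "0 \<le> r u" "r u powr m = V u" "G u = r u * H u / \<epsilon>" using elim by (auto simp: V_def)
              have r0: "0 < r u" using r posV[OF u(1,2)] m by (cases "r u = 0") auto
              have "h' (V u) = \<epsilon> * r u powr (m * (- 1 / m))"
                unfolding h'_def c\<theta>(5) r(2)[symmetric] powr_powr ..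
              also have "\<dots> = \<epsilon> / r u" using r0 m by (simp add: powr_minus divide_inverse)
              \<comment> \<open>Here \<open>h' (V u)\<close> is \<open>\<epsilon> / r u\<close>, so
                this is the equation after division by \<open>r u\<close>, legitimate because
                \<open>V u > 0\<close>.\<close>
              finally have "H u = h' (V u) * G u" using r(3) r0 eps by simp
              then have "\<bar>h' (V a) * G u - H u\<bar> = \<bar>h' (V a) - h' (V u)\<bar> * \<bar>G u\<bar>"
                by (simp add: abs_mult[symmetric] left_diff_distrib)
              also have "\<dots> \<le> \<eta> * \<bar>G u\<bar>"
              proof (rule mult_right_mono)
                have "dist a u < \<delta>" using a True st by (auto simp: dist_real_def abs_if)
                then have "dist (h' (V a)) (h' (V u)) < \<eta>"
                  using a True st by (intro uc) auto
                then show "\<bar>h' (V a) - h' (V u)\<bar> \<le> \<eta>" by (simp add: dist_real_def)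
              qed simp
              finally show ?thesis using True by simp
            qed simp
          qed
        qed
        also have "(LINT u|lborel. \<eta> * (indicator {s<..t} u * \<bar>G u\<bar>)) = \<eta> * (L t - L s)"
          using dL by (simp add: L_def)
        finally show ?thesis .
      qed
      have "D t - D s \<le> h' (V s) * (V t - V s) - (prim H t - prim H s)"
        using tangent[of "V s" "V t"] posV[of s] posV[of t] st by (simp add: D_def)
      moreover have "h' (V t) * (V t - V s) - (prim H t - prim H s) \<le> D t - D s"
        using tangent[of "V t" "V s"] posV[of s] posV[of t] st by (simp add: D_def algebra_simps)
      ultimately show ?thesis using key[of s] key[of t] st by auto
    qed
    show ?thesis
    proof (rule small_step_induct[OF pq(2) \<delta>, where P="\<lambda>t. \<bar>D t - D p\<bar> \<le> \<eta> * (L t - L p)"])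
      show "\<bar>D p - D p\<bar> \<le> \<eta> * (L p - L p)" by simp
      fix s t assume st: "p \<le> s" "s \<le> t" "t \<le> q" "t - s < \<delta>" and IH: "\<bar>D s - D p\<bar> \<le> \<eta> * (L s - L p)"
      have "\<bar>D t - D p\<bar> \<le> \<bar>D t - D s\<bar> + \<bar>D s - D p\<bar>" by simp
      also have "\<dots> \<le> \<eta> * (L t - L s) + \<eta> * (L s - L p)" using inc[OF st] IH by simp
      also have "\<dots> = \<eta> * (L t - L p)" by (simp add: algebra_simps)
      finally show "\<bar>D t - D p\<bar> \<le> \<eta> * (L t - L p)" .
    qed
  qed
  have "D q = D p"
  proof (rule ccontr)
    assume ne: "D q \<noteq> D p"
    have "0 \<le> L q - L p"
      using small[of 1] by simp
    \<comment> \<open>\<open>\<eta>\<close> is chosen so that the bound falls below half of the left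
      side; the added 1 keeps the denominator positive when \<open>L q = L p\<close>.\<close>
    then have "\<bar>D q - D p\<bar> \<le> \<bar>D q - D p\<bar> / (2 * (L q - L p + 1)) * (L q - L p)"
      using ne by (intro small) auto
    also have "\<dots> = \<bar>D q - D p\<bar> * ((L q - L p) / (2 * (L q - L p + 1)))" by simp
    also have "\<dots> < \<bar>D q - D p\<bar> * 1"
      using ne \<open>0 \<le> L q - L p\<close> by (intro mult_strict_left_mono) (auto simp: pos_divide_less_eq)
    finally show False by simp
  qed
  then show ?thesis by (simp add: D_def V_def c_def \<theta>_def)
qed

text \<open>If the claim failed, the difference \<open>D\<close> would start positive and keep its
  value along the half-line, which bounds \<open>r\<close> below there and contradicts
  \<open>fin\<close>.\<close>

lemma pressure_le:
  fixes H G r :: "real \<Rightarrow> real"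
  assumes eps: "\<epsilon> > 0" and m: "m > 1"
    and iG: "\<And>s. integrable lborel (\<lambda>t. indicator {0..s} t * G t)"
    and iH: "\<And>s. integrable lborel (\<lambda>t. indicator {0..s} t * H t)"
    and ae: "AE t in lborel. 0 \<le> t \<longrightarrow> 0 \<le> r t \<and> r t powr m = v0 + prim G t \<and> G t = r t * H t / \<epsilon>"
    and ae2: "AE t in lborel. 0 \<le> t \<longrightarrow> 0 \<le> \<phi>0 + prim H t"
    and fin: "(\<integral>\<^sup>+t. ennreal (r t) \<partial>lborel) < \<infinity>"
  shows "\<epsilon> * m / (m - 1) * v0 powr ((m - 1) / m) \<le> \<phi>0"
proof (rule ccontr)
  define c where "c = \<epsilon> * m / (m - 1)"
  define \<theta> where "\<theta> = (m - 1) / m"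
  define V where "V t = v0 + prim G t" for t
  define \<Phi> where "\<Phi> t = \<phi>0 + prim H t" for t
  define D where "D t = c * V t powr \<theta> - \<Phi> t" for t
  have c: "0 < c" "0 < \<theta>" using eps m by (auto simp: c_def \<theta>_def)
  have contV: "continuous_on {0..q} V" for q
    unfolding V_def by (intro continuous_intros continuous_on_prim iG)
  have cont\<Phi>: "continuous_on {0..q} \<Phi>" for q
    unfolding \<Phi>_def by (intro continuous_intros continuous_on_prim iH)
  \<comment> \<open>The hypotheses hold only almost everywhere, but the primitives are continuous,
    so the signs of \<open>V\<close> and \<open>\<Phi>\<close> are available at every point.\<close>
  have V: "0 \<le> V t" if "0 \<le> t" for t
  proof (rule AE_nonneg_imp_nonneg[OF contV _ that])
    show "AE t in lborel. 0 \<le> t \<longrightarrow> 0 \<le> V t"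
      using ae by eventually_elim (metis V_def powr_ge_zero)
  qed
  have \<Phi>: "0 \<le> \<Phi> t" if "0 \<le> t" for t
    by (rule AE_nonneg_imp_nonneg[OF cont\<Phi> _ that]) (use ae2 in \<open>simp add: \<Phi>_def\<close>)
  assume "\<not> \<epsilon> * m / (m - 1) * v0 powr ((m - 1) / m) \<le> \<phi>0"
  then have a: "0 < D 0" by (simp add: D_def V_def \<Phi>_def c_def \<theta>_def prim_0)
  have const: "D q = D 0" if q: "0 \<le> q" for q
  proof -
    have "continuous_on {0..q} D"
      unfolding D_def using contV cont\<Phi> V c by (intro continuous_intros continuous_on_powr') auto
    then have "uniformly_continuous_on {0..q} D" by (intro compact_uniformly_continuous) auto
    then obtain \<delta> where \<delta>: "0 < \<delta>"
      and uc: "\<And>s t. s \<in> {0..q} \<Longrightarrow> t \<in> {0..q} \<Longrightarrow> dist t s < \<delta> \<Longrightarrow> dist (D t) (D s) < D 0"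
      unfolding uniformly_continuous_on_def using a by metis
    show ?thesis
    proof (rule small_step_induct[OF q \<delta>, where P="\<lambda>t. D t = D 0"])
      \<comment> \<open>Within one step \<open>D\<close> moves by less than \<open>D 0\<close> and
        so stays positive. As \<open>\<Phi> \<ge> 0\<close>, this forces \<open>V > 0\<close> on the
        step, as \<open>pressure_const\<close> requires.\<close>
      fix s t assume st: "0 \<le> s" "s \<le> t" "t \<le> q" "t - s < \<delta>" and Ds: "D s = D 0"
      have "0 < V u" if u: "s \<le> u" "u \<le> t" for u
      proof -
        have "0 < D u" using uc[of s u] u st Ds by (auto simp: dist_real_def)
        then have "0 < c * V u powr \<theta>" using \<Phi>[of u] u st by (simp add: D_def)
        then have "V u \<noteq> 0" by auto
        then show ?thesis using V[of u] u st by simp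
      qed
      from pressure_const[OF eps m iG iH ae st(1,2) this[unfolded V_def]]
      have "D t = D s" by (simp add: D_def V_def \<Phi>_def c_def \<theta>_def)
      then show "D t = D 0" using Ds by simp
    qed simp
  qed
  \<comment> \<open>The value of \<open>r\<close> at which \<open>c * r powr (m - 1)\<close> equals
    \<open>D 0\<close>.\<close>
  define \<kappa> where "\<kappa> = (D 0 / c) powr (1 / (m - 1))"
  have \<kappa>: "0 < \<kappa>" using a c by (simp add: \<kappa>_def)
  have lower: "AE t in lborel. 0 \<le> t \<longrightarrow> \<kappa> \<le> r t"
    using ae
  proof eventually_elim
    case (elim t)
    show ?case
    proof
      assume t: "0 \<le> t"
      then have r: "0 \<le> r t" "r t powr m = V t" using elim by (auto simp: V_def)
      have "D 0 \<le> c * V t powr \<theta>" using const[OF t] \<Phi>[OF t] by (simp add: D_def)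
      then have "D 0 / c \<le> V t powr \<theta>" using c by (simp add: pos_divide_le_eq mult.commute)
      also have "V t powr \<theta> = r t powr (m - 1)"
        unfolding r(2)[symmetric] powr_powr using m by (simp add: \<theta>_def)
      finally have "\<kappa> \<le> (r t powr (m - 1)) powr (1 / (m - 1))"
        unfolding \<kappa>_def using a c m by (intro powr_mono2) auto
      also have "\<dots> = r t" using r(1) m by (simp add: powr_powr)
      finally show "\<kappa> \<le> r t" .
    qed
  qed
  obtain B where B: "(\<integral>\<^sup>+t. ennreal (r t) \<partial>lborel) = ennreal B" "0 \<le> B"
    using fin by (metis enn2real_nonneg ennreal_enn2real infinity_ennreal_def)
  obtain N :: nat where N: "B / \<kappa> < real N" using reals_Archimedean2 by blast
  have "ennreal (\<kappa> * real N) = (\<integral>\<^sup>+t. ennreal \<kappa> * indicator {0..real N} t \<partial>lborel)"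
    using \<kappa> by (subst nn_integral_cmult_indicator) (auto simp: ennreal_mult)
  also have "\<dots> \<le> (\<integral>\<^sup>+t. ennreal (r t) \<partial>lborel)"
    using lower by (intro nn_integral_mono_AE) (auto elim!: eventually_mono simp: indicator_def intro: ennreal_leI)
  finally have "\<kappa> * real N \<le> B" using B by simp
  then show False using N \<kappa> by (simp add: pos_divide_less_eq mult.commute)
qed

section \<open>The bound\<close>

text \<open>The exceptional set of \<open>x\<close> in \<open>seg\<close> depends on
  \<open>s\<close>. Fubini exchanges the quantifiers: on the line through almost every
  \<open>x\<close>, almost every \<open>s\<close> is good.\<close>

lemma AE_AE_segment:
  fixes u g :: "'a::euclidean_space \<Rightarrow> real"
  assumes [measurable]: "u \<in> borel_measurable borel" "g \<in> borel_measurable borel"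
    and seg: "\<And>s. 0 \<le> s \<Longrightarrow> AE x in lborel. u (x + s *\<^sub>R b) - u x = segint b g s x"
  shows "AE x in lborel. AE s in lborel. 0 \<le> s \<longrightarrow> u (x + s *\<^sub>R b) - u x = segint b g s x"
proof -
  have "AE s in lborel. AE x in lborel. 0 \<le> s \<longrightarrow> u (x + s *\<^sub>R b) - u x = segint b g s x"
  proof (rule AE_I2)
    fix s :: real
    show "AE x in lborel. 0 \<le> s \<longrightarrow> u (x + s *\<^sub>R b) - u x = segint b g s x"
      by (cases "0 \<le> s") (use seg[of s] in auto)
  qed
  moreover have "(AE x in lborel. AE s in lborel. 0 \<le> s \<longrightarrow> u (x + s *\<^sub>R b) - u x = segint b g s x)
      \<longleftrightarrow> (AE s in lborel. AE x in lborel. 0 \<le> s \<longrightarrow> u (x + s *\<^sub>R b) - u x = segint b g s x)"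
  proof (rule lborel_pair.AE_commute)
    have [measurable]: "(\<lambda>z. segint b g (snd z) (fst z)) \<in> borel_measurable (lborel \<Otimes>\<^sub>M lborel)"
      using measurable_segint_pair[of g b] by simp
    show "{z \<in> space (lborel \<Otimes>\<^sub>M lborel). 0 \<le> snd z \<longrightarrow> u (fst z + snd z *\<^sub>R b) - u (fst z) = segint b g (snd z) (fst z)}
        \<in> sets (lborel \<Otimes>\<^sub>M lborel)"
      by measurable
  qed
  ultimately show ?thesis by blast
qed

context attractive_kernel
begin

text \<open>Both increment formulas hold on the half-line from almost every \<open>x\<close>, with
  the actual values at \<open>x\<close> as initial values. The one-dimensional inequality at the
  start of the half-line is thus already the claim at \<open>x\<close>, and no continuous
  representative is needed.\<close>

lemma pressure_le_conv:
  fixes r :: "'a \<Rightarrow> real"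
  assumes eps: "\<epsilon> > 0" and m: "m > 1" and b: "norm b = 1"
    and r: "\<And>x. 0 \<le> r x" "integrable lborel r"
    and N: "\<And>x. N x = (LINT y|lborel. r y * DV b (x - y))"
    and v: "loc_integrable (\<lambda>x. r x powr m)" and g: "loc_integrable (\<lambda>x. r x * N x / \<epsilon>)"
    and distr: "\<And>\<phi>. test_function \<phi> \<Longrightarrow> - (LINT x|lborel. r x powr m * (grad \<phi> x \<bullet> b))
        = (LINT x|lborel. r x * N x / \<epsilon> * \<phi> x)"
  shows "AE x in lborel. \<epsilon> * m / (m - 1) * r x powr (m - 1) \<le> (LINT y|lborel. r y * V (x - y))"
proof -
  define \<Phi> where "\<Phi> x = (LINT y|lborel. r y * V (x - y))" for x
  have [measurable]: "r \<in> borel_measurable borel" using r by auto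
  have N_eq: "N = (\<lambda>x. LINT y|lborel. r y * DV b (x - y))" using N by (simp add: fun_eq_iff)
  have [measurable]: "N \<in> borel_measurable borel" "\<Phi> \<in> borel_measurable borel"
    unfolding N_eq \<Phi>_def by measurable
  have "integrable lborel N"
    unfolding N_eq using lborel_pair.integrable_fst[OF integrable_conv_pair[OF r(2) integrable_DV[OF b]]] .
  then have N_loc: "loc_integrable N" by (rule integrable_imp_loc_integrable)
  have \<Phi>0: "0 \<le> \<Phi> x" for x
    unfolding \<Phi>_def using r V_nonneg by (intro integral_nonneg_AE) auto
  have "AE x in lborel. AE s in lborel. 0 \<le> s \<longrightarrow>
      r (x + s *\<^sub>R b) powr m - r x powr m = segint b (\<lambda>x. r x * N x / \<epsilon>) s x"
    by (rule AE_AE_segment[OF _ _ distr_deriv_segment[OF v g b _ distr]]) measurable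
  moreover have "AE x in lborel. AE s in lborel. 0 \<le> s \<longrightarrow> \<Phi> (x + s *\<^sub>R b) - \<Phi> x = segint b N s x"
    unfolding \<Phi>_def N_eq
    by (rule AE_AE_segment[OF _ _ conv_segment[OF r(2) integrable_V integrable_DV[OF b] _ V_segment[OF b]]]) measurable
  moreover have "AE x in lborel. (\<integral>\<^sup>+t. ennreal (r (x + t *\<^sub>R b)) \<partial>lborel) < \<infinity>"
    by (rule AE_nn_integral_line_finite[OF _ _ b]) (use r in \<open>auto simp: integrable_iff_bounded\<close>)
  moreover note AE_integrable_segment[OF g b] AE_integrable_segment[OF N_loc b]
  ultimately show ?thesis
  proof eventually_elim
    case (elim x)
    have "\<epsilon> * m / (m - 1) * (r x powr m) powr ((m - 1) / m) \<le> \<Phi> x"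
    proof (rule pressure_le[OF eps m, where r="\<lambda>t. r (x + t *\<^sub>R b)" and H="\<lambda>t. N (x + t *\<^sub>R b)"
          and G="\<lambda>t. r (x + t *\<^sub>R b) * N (x + t *\<^sub>R b) / \<epsilon>"])
      show "AE t in lborel. 0 \<le> t \<longrightarrow> 0 \<le> r (x + t *\<^sub>R b) \<and>
          r (x + t *\<^sub>R b) powr m = r x powr m + prim (\<lambda>t. r (x + t *\<^sub>R b) * N (x + t *\<^sub>R b) / \<epsilon>) t \<and>
          r (x + t *\<^sub>R b) * N (x + t *\<^sub>R b) / \<epsilon> = r (x + t *\<^sub>R b) * N (x + t *\<^sub>R b) / \<epsilon>"
        using elim(1)
      proof eventually_elim
        case (elim t)
        show ?case using elim r(1)[of "x + t *\<^sub>R b"] unfolding prim_def segint_def by linarith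
      qed
      show "AE t in lborel. 0 \<le> t \<longrightarrow> 0 \<le> \<Phi> x + prim (\<lambda>t. N (x + t *\<^sub>R b)) t"
        using elim(2)
      proof eventually_elim
        case (elim t)
        show ?case using elim \<Phi>0[of "x + t *\<^sub>R b"] unfolding prim_def segint_def by linarith
      qed
    qed (use elim in auto)
    moreover have "(r x powr m) powr ((m - 1) / m) = r x powr (m - 1)"
      using m by (simp add: powr_powr)
    ultimately show ?case by (simp add: \<Phi>_def)
  qed
qed

text \<open>For \<open>I > 0\<close>, \<open>M\<close> solves
  \<open>c * M powr (m - 1) = I * M\<close>. Dividing \<open>r\<close> by \<open>M\<close> and
  \<open>V\<close> by \<open>I\<close> therefore normalises every constant to 1.\<close>

lemma bound_of_pressure_le_conv:
  fixes r :: "'a \<Rightarrow> real"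
  assumes eps: "\<epsilon> > 0" and m: "m > 2" and r: "\<And>x. 0 \<le> r x" "integrable lborel r"
    and le: "AE x in lborel. \<epsilon> * m / (m - 1) * r x powr (m - 1) \<le> (LINT y|lborel. r y * V (x - y))"
  shows "AE x in lborel. r x \<le> ((m - 1) / (m * \<epsilon>) * (LINT x|lborel. V x)) powr (1 / (m - 2))"
proof -
  define I where "I = (LINT x|lborel. V x)"
  define c where "c = \<epsilon> * m / (m - 1)"
  define M where "M = ((m - 1) / (m * \<epsilon>) * I) powr (1 / (m - 2))"
  have c: "0 < c" using eps m by (simp add: c_def)
  have I0: "0 \<le> I" unfolding I_def using V_nonneg by (intro integral_nonneg_AE) auto
  have "AE x in lborel. r x \<le> M"
  \<comment> \<open>Normalising \<open>V\<close> requires positive mass. For mass 0 the convolution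
    vanishes and the inequality itself gives \<open>r = 0\<close>.\<close>
  proof (cases "I = 0")
    case True
    then have "AE y in lborel. V y = 0"
      using integral_nonneg_eq_0_iff_AE[OF integrable_V] V_nonneg by (auto simp: I_def)
    then have "(LINT y|lborel. r y * V (x - y)) = 0" for x
      by (intro integral_eq_zero_AE) (use AE_reflect[of "\<lambda>y. V y = 0" x] in \<open>auto elim: eventually_mono\<close>)
    with le have "AE x in lborel. c * r x powr (m - 1) \<le> 0" by (simp add: c_def)
    then show ?thesis
    proof eventually_elim
      case (elim x)
      then have "r x powr (m - 1) \<le> 0" using c by (simp add: mult_le_0_iff)
      then have "r x = 0" using r(1)[of x] by (simp add: powr_gt_zero order.antisym)
      then show ?case by (simp add: M_def)
    qed
  next
    case False
    then have I: "0 < I" using I0 by simp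
    have A: "(m - 1) / (m * \<epsilon>) * I = I / c" using eps m by (simp add: c_def field_simps)
    have M: "0 < M" using I c unfolding M_def A by simp
    have "M powr (m - 2) = I / c" using I c m unfolding M_def A by (simp add: powr_powr)
    then have M1: "M powr (m - 1) = I / c * M"
      using M powr_add[of M "m - 2" 1] by simp
    have "AE x in lborel. r x / M \<le> 1"
    proof (rule AE_le_1_of_conv_bound[where k="\<lambda>x. V x / I" and \<alpha>="m - 1"])
      show "AE x in lborel. (r x / M) powr (m - 1) \<le> (LINT y|lborel. r y / M * (V (x - y) / I))"
        using le
      proof eventually_elim
        case (elim x)
        have "(r x / M) powr (m - 1) = (c * r x powr (m - 1)) / (I * M)"
          using r(1)[of x] M I c by (simp add: powr_divide M1)
        also have "\<dots> \<le> (LINT y|lborel. r y * V (x - y)) / (I * M)"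
          using elim I M by (intro divide_right_mono) (auto simp: c_def)
        also have "\<dots> = (LINT y|lborel. r y / M * (V (x - y) / I))" by (simp add: mult.commute)
        finally show ?case .
      qed
    qed (use r M I m V_nonneg integrable_V in \<open>auto simp: I_def\<close>)
    then show ?thesis by eventually_elim (use M in \<open>simp add: pos_divide_le_eq\<close>)
  qed
  then show ?thesis by (simp add: M_def I_def)
qed

end

text \<open>The complement is a union of possibly uncountably many open sets; by Lindelof countably
  many of them cover it, so the exceptional sets still form a null set.\<close>

lemma AE_notin_ess_supp:
  fixes f :: "'a::euclidean_space \<Rightarrow> real"
  shows "AE x in lebesgue. x \<notin> ess_supp f \<longrightarrow> f x = 0"
proof -
  define F where "F = {U. open U \<and> (AE x in lebesgue. x \<in> U \<longrightarrow> f x = 0)}"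
  have "\<And>S. S \<in> F \<Longrightarrow> open S" by (simp add: F_def)
  then obtain F' where F': "F' \<subseteq> F" "countable F'" "\<Union>F' = \<Union>F"
    using Lindelof[of F] by blast
  have "AE x in lebesgue. \<forall>U\<in>F'. x \<in> U \<longrightarrow> f x = 0"
    by (rule AE_ball_countable[OF F'(2), THEN iffD2]) (use F'(1) in \<open>auto simp: F_def\<close>)
  then show ?thesis
    by eventually_elim (use F'(3) in \<open>auto simp: ess_supp_def F_def[symmetric]\<close>)
qed

text \<open>On bounded sets \<open>t \<le> 1 + t powr p\<close> reduces local p-integrability to
  local integrability; for the Borel function \<open>u\<close> the Lebesgue integral is then one
  over \<open>lborel\<close>.\<close>

lemma loc_integrable_of_Lp_loc:
  fixes f :: "'a::euclidean_space \<Rightarrow> 'b::euclidean_space"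
  assumes p: "1 \<le> p" and f: "Lp_loc p f" and [measurable]: "u \<in> borel_measurable borel"
    and le: "AE x in lebesgue. \<bar>u x\<bar> \<le> norm (f x)"
  shows "loc_integrable u"
  unfolding loc_integrable_def
proof (intro conjI allI)
  show "u \<in> borel_measurable borel" by fact
  fix R
  have f': "integrable lebesgue (\<lambda>x. indicator (cball 0 R) x * norm (f x) powr p)"
    using f by (simp add: Lp_loc_def set_integrable_def)
  have "integrable lebesgue (\<lambda>x. indicator (cball 0 R) x :: real)"
    by (rule integrable_real_indicator) (auto simp: emeasure_bounded_finite[unfolded infinity_ennreal_def])
  from Bochner_Integration.integrable_add[OF this f']
  have "integrable lebesgue (\<lambda>x. indicator (ball 0 R) x * u x)"
  proof (rule Bochner_Integration.integrable_bound)
    show "(\<lambda>x. indicator (ball 0 R) x * u x) \<in> borel_measurable lebesgue"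
      by (rule measurable_completion) measurable
    show "AE x in lebesgue. norm (indicator (ball 0 R) x * u x)
        \<le> norm (indicator (cball 0 R) x + indicator (cball 0 R) x * norm (f x) powr p)"
      using le
    proof eventually_elim
      case (elim x)
      have "norm (f x) \<le> 1 + norm (f x) powr p"
      proof (cases "norm (f x) \<le> 1")
        case False
        then have "norm (f x) powr 1 \<le> norm (f x) powr p" using p by (intro powr_mono) auto
        then show ?thesis by simp
      qed (simp add: add_increasing2)
      then show ?case using elim by (auto simp: indicator_def)
    qed
  qed
  then show "integrable lborel (\<lambda>x. indicator (ball 0 R) x * u x)"
    by (subst (asm) integrable_completion) measurable
qed

theorem theorem3p1:
  fixes W :: "'a::euclidean_space \<Rightarrow> real" and \<omega> :: "real \<Rightarrow> real"
    and \<rho> :: "'a \<Rightarrow> real" and \<epsilon> m :: real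
  assumes eps: "\<epsilon> > 0"
    and m: "m > 2"
    and W1_C1: "C1_on (- {0}) W"
    and W1_radial: "\<forall>x. x \<noteq> 0 \<longrightarrow> W x = \<omega> (norm x)"
    and W2: "\<exists>C>0. \<forall>r. 0 < r \<and> r \<le> 1 \<longrightarrow> deriv \<omega> r \<le> C * r powr (1 - real DIM('a))"
    and W4_pos: "\<forall>r. 0 < r \<and> r < 1 \<longrightarrow> deriv \<omega> r > 0"
    and W4_zero: "\<forall>r\<ge>1. deriv \<omega> r = 0 \<and> \<omega> r = 0"
    and stat: "stationary_state \<epsilon> m W \<rho>"
  shows "AE x in lebesgue.
    \<rho> x \<le> ((m - 1) / (m * \<epsilon>) * (LINT x|lebesgue. \<bar>W x\<bar>)) powr (1 / (m - 2))"
proof -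
  interpret attractive_kernel W \<omega>
    using W1_C1 W1_radial W2 W4_pos W4_zero by unfold_locales auto
  note st = stat[unfolded stationary_state_def]
  obtain b :: 'a where bB: "b \<in> Basis" using nonempty_Basis by blast
  then have b: "norm b = 1" "b \<noteq> 0" by auto
  have \<rho>: "integrable lebesgue \<rho>" using st by blast
  then have \<rho>m[measurable]: "\<rho> \<in> borel_measurable lebesgue" by auto
  obtain r0 where [measurable]: "r0 \<in> borel_measurable lborel" and r0: "AE x in lborel. \<rho> x = r0 x"
    using completion_ex_borel_measurable_real[OF \<rho>m] by blast
  \<comment> \<open>A Borel representative of \<rho>; truncation makes it nonnegative everywhere and
    stays in the class because \<rho> is nonnegative almost everywhere.\<close>
  define r where "r x = max 0 (r0 x)" for x
  have rm[measurable]: "r \<in> borel_measurable borel" unfolding r_def by measurable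
  have r_nonneg: "0 \<le> r x" for x by (simp add: r_def)
  have \<rho>r: "AE x in lebesgue. \<rho> x = r x"
    using AE_completion[OF r0] conjunct1[OF conjunct2[OF st]]
    by eventually_elim (auto simp: r_def)
  have meas_leb: "f \<in> borel_measurable lebesgue" if "f \<in> borel_measurable borel" for f :: "'a \<Rightarrow> real"
    using that by (intro measurable_completion) simp
  have "integrable lebesgue r"
    using integrable_cong_AE[OF \<rho>m meas_leb[OF rm] \<rho>r] \<rho> by blast
  then have r_int: "integrable lborel r"
    by (subst (asm) integrable_completion) measurable
  define N where "N x = (LINT y|lborel. r y * DV b (x - y))" for x
  have [measurable]: "N \<in> borel_measurable borel" unfolding N_def by measurable
  \<comment> \<open>At almost every \<open>x\<close> the vector-valued integrand is integrable by
    stationarity, so the inner product with \<open>b\<close> may be taken inside. The point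
    \<open>y = x\<close>, where \<open>DV\<close> sees the origin, is a null set.\<close>
  have conv_N: "AE x in lebesgue. conv (grad W) \<rho> x \<bullet> b = - N x"
    using conjunct1[OF conjunct2[OF conjunct2[OF conjunct2[OF st]]]]
  proof eventually_elim
    case (elim x)
    have "conv (grad W) \<rho> x \<bullet> b = (LINT y|lebesgue. (\<rho> y *\<^sub>R grad W (x - y)) \<bullet> b)"
      unfolding conv_def by (rule integral_inner_left[symmetric]) (rule elim)
    also have "\<dots> = (LINT y|lebesgue. - (r y * DV b (x - y)))"
    proof (rule integral_cong_AE)
      show "AE y in lebesgue. (\<rho> y *\<^sub>R grad W (x - y)) \<bullet> b = - (r y * DV b (x - y))"
        using \<rho>r AE_completion[OF AE_lborel_singleton[of x]]
        by eventually_elim (auto simp: DV_def)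
      show "(\<lambda>y. - (r y * DV b (x - y))) \<in> borel_measurable lebesgue"
        by (rule meas_leb) measurable
      show "(\<lambda>y. (\<rho> y *\<^sub>R grad W (x - y)) \<bullet> b) \<in> borel_measurable lebesgue"
        by (rule borel_measurable_inner[OF borel_measurable_integrable[OF elim] borel_measurable_const])
    qed
    also have "\<dots> = (LINT y|lborel. - (r y * DV b (x - y)))"
      by (rule integral_completion) measurable
    finally show ?case by (simp add: N_def)
  qed
  have v: "loc_integrable (\<lambda>x. r x powr m)"
  proof (rule loc_integrable_of_Lp_loc[of 2 "\<lambda>x. \<rho> x powr m"])
    show "Lp_loc 2 (\<lambda>x. \<rho> x powr m)" using st by (simp add: H1_loc_def)
    show "AE x in lebesgue. \<bar>r x powr m\<bar> \<le> norm (\<rho> x powr m)"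
      using \<rho>r by eventually_elim simp
  qed auto
  have "loc_integrable (\<lambda>x. r x * N x)"
  proof (rule loc_integrable_of_Lp_loc[of 1 "\<lambda>x. \<rho> x *\<^sub>R conv (grad W) \<rho> x"])
    show "Lp_loc 1 (\<lambda>x. \<rho> x *\<^sub>R conv (grad W) \<rho> x)" using st by blast
    show "AE x in lebesgue. \<bar>r x * N x\<bar> \<le> norm (\<rho> x *\<^sub>R conv (grad W) \<rho> x)"
      using \<rho>r conv_N
    proof eventually_elim
      case (elim x)
      have "\<bar>N x\<bar> = \<bar>conv (grad W) \<rho> x \<bullet> b\<bar>" using elim by simp
      also have "\<dots> \<le> norm (conv (grad W) \<rho> x)"
        using Cauchy_Schwarz_ineq2[of "conv (grad W) \<rho> x" b] b by simp
      finally show ?case using elim by (simp add: abs_mult mult_left_mono)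
    qed
  qed auto
  then have g: "loc_integrable (\<lambda>x. r x * N x / \<epsilon>)"
    unfolding loc_integrable_def by (simp add: divide_inverse mult.assoc[symmetric])
  have "AE x in lborel. \<epsilon> * m / (m - 1) * r x powr (m - 1) \<le> (LINT y|lborel. r y * V (x - y))"
  proof (rule pressure_le_conv[OF eps _ b(1) r_nonneg r_int N_def v g])
    show "m > 1" using m by simp
    fix \<phi> :: "'a \<Rightarrow> real" assume \<phi>: "test_function \<phi>"
    have Ck: "Ck k \<phi>" for k using \<phi> by (simp add: test_function_def)
    have "continuous_on UNIV \<phi>" using Ck[of 0] by simp
    then have \<phi>m[measurable]: "\<phi> \<in> borel_measurable borel" by (rule borel_measurable_continuous_onI)
    have "continuous_on UNIV (\<lambda>x. grad \<phi> x \<bullet> b)" using Ck[of "Suc 0"] bB by simp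
    then have [measurable]: "(\<lambda>x. grad \<phi> x \<bullet> b) \<in> borel_measurable borel" by (rule borel_measurable_continuous_onI)
    have d: "- (LINT x|lebesgue. \<epsilon> * \<rho> x powr m * (grad \<phi> x \<bullet> b)) =
        (LINT x|lebesgue. - (indicator (ess_supp \<rho>) x * \<rho> x * (conv (grad W) \<rho> x \<bullet> b)) * \<phi> x)"
      using st bB \<phi> unfolding distr_deriv_def by blast
    have "(LINT x|lebesgue. \<epsilon> * \<rho> x powr m * (grad \<phi> x \<bullet> b)) = (LINT x|lebesgue. \<epsilon> * (r x powr m * (grad \<phi> x \<bullet> b)))"
    proof (rule integral_cong_AE)
      show "AE x in lebesgue. \<epsilon> * \<rho> x powr m * (grad \<phi> x \<bullet> b) = \<epsilon> * (r x powr m * (grad \<phi> x \<bullet> b))"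
        using \<rho>r by eventually_elim simp
      show "(\<lambda>x. \<epsilon> * (r x powr m * (grad \<phi> x \<bullet> b))) \<in> borel_measurable lebesgue"
        by (rule meas_leb) measurable
      have [measurable]: "(\<lambda>x. grad \<phi> x \<bullet> b) \<in> borel_measurable lebesgue"
        by (rule meas_leb) measurable
      show "(\<lambda>x. \<epsilon> * \<rho> x powr m * (grad \<phi> x \<bullet> b)) \<in> borel_measurable lebesgue" by measurable
    qed
    also have "\<dots> = (LINT x|lborel. \<epsilon> * (r x powr m * (grad \<phi> x \<bullet> b)))"
      by (rule integral_completion) measurable
    finally have 1: "(LINT x|lebesgue. \<epsilon> * \<rho> x powr m * (grad \<phi> x \<bullet> b)) = \<epsilon> * (LINT x|lborel. r x powr m * (grad \<phi> x \<bullet> b))"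
      by simp
    have "(LINT x|lebesgue. - (indicator (ess_supp \<rho>) x * \<rho> x * (conv (grad W) \<rho> x \<bullet> b)) * \<phi> x)
        = (LINT x|lebesgue. \<epsilon> * (r x * N x / \<epsilon> * \<phi> x))"
    proof -
      \<comment> \<open>The indicator disappears because \<rho> vanishes almost everywhere off
        \<open>ess_supp \<rho>\<close>.\<close>
      have "AE x in lebesgue. - (indicator (ess_supp \<rho>) x * \<rho> x * (conv (grad W) \<rho> x \<bullet> b)) * \<phi> x
          = \<epsilon> * (r x * N x / \<epsilon> * \<phi> x)"
        using \<rho>r conv_N AE_notin_ess_supp[of \<rho>]
        by eventually_elim (use eps in \<open>auto simp: indicator_def\<close>)
      moreover have "(\<lambda>x. - (indicator (ess_supp \<rho>) x * \<rho> x * (conv (grad W) \<rho> x \<bullet> b)) * \<phi> x) \<in> borel_measurable lebesgue"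
      proof -
        have [measurable]: "conv (grad W) \<rho> \<in> borel_measurable lebesgue"
          using st by (simp add: Lp_loc_def)
        have "closed (ess_supp \<rho>)" unfolding ess_supp_def by (intro closed_Compl open_Union) auto
        then have [measurable]: "ess_supp \<rho> \<in> sets lebesgue" by simp
        have [measurable]: "\<phi> \<in> borel_measurable lebesgue" by (rule meas_leb[OF \<phi>m])
        show ?thesis by measurable
      qed
      ultimately show ?thesis
        by (intro integral_cong_AE) (auto intro!: meas_leb)
    qed
    also have "\<dots> = (LINT x|lborel. \<epsilon> * (r x * N x / \<epsilon> * \<phi> x))"
      by (rule integral_completion) measurable
    finally have 2: "(LINT x|lebesgue. - (indicator (ess_supp \<rho>) x * \<rho> x * (conv (grad W) \<rho> x \<bullet> b)) * \<phi> x)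
        = \<epsilon> * (LINT x|lborel. r x * N x / \<epsilon> * \<phi> x)"
      by (simp only: integral_mult_right_zero)
    have "\<epsilon> * - (LINT x|lborel. r x powr m * (grad \<phi> x \<bullet> b)) = \<epsilon> * (LINT x|lborel. r x * N x / \<epsilon> * \<phi> x)"
      using d unfolding 1 2 by simp
    then show "- (LINT x|lborel. r x powr m * (grad \<phi> x \<bullet> b)) = (LINT x|lborel. r x * N x / \<epsilon> * \<phi> x)"
      using eps by (simp only: mult_cancel_left) auto
  qed
  from bound_of_pressure_le_conv[OF eps m r_nonneg r_int this]
  have le: "AE x in lborel. r x \<le> ((m - 1) / (m * \<epsilon>) * (LINT x|lborel. V x)) powr (1 / (m - 2))" .
  have "(LINT x|lborel. V x) = (LINT x|lebesgue. V x)"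
    by (rule integral_completion[symmetric]) measurable
  also have "\<dots> = (LINT x|lebesgue. \<bar>W x\<bar>)"
  proof (rule integral_cong_AE)
    show "V \<in> borel_measurable lebesgue" by (rule meas_leb) measurable
    show ae: "AE x in lebesgue. V x = \<bar>W x\<bar>"
      using AE_completion[OF AE_lborel_singleton[of "0::'a"]]
      by eventually_elim (use W_nonpos_le_bound in \<open>auto simp: V_def\<close>)
    \<comment> \<open>\<open>W 0\<close> is arbitrary, so \<open>\<bar>W\<bar>\<close> is the Borel
      function \<open>V\<close> modified at one point.\<close>
    have "(\<lambda>x. \<bar>W x\<bar>) = (\<lambda>x. if x = 0 then \<bar>W 0\<bar> else V x)"
      using W_nonpos_le_bound by (auto simp: V_def fun_eq_iff)
    also have "\<dots> \<in> borel_measurable lebesgue" by (rule meas_leb) measurable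
    finally show "(\<lambda>x. \<bar>W x\<bar>) \<in> borel_measurable lebesgue" .
  qed
  finally have V: "(LINT x|lborel. V x) = (LINT x|lebesgue. \<bar>W x\<bar>)" .
  show ?thesis using AE_completion[OF le] \<rho>r by eventually_elim (simp add: V)
qed

end
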